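(* Assume the setting below. Let $\mathcal{S}=\{j\in\mathcal{A}:\zeta_j<1\}$ and $\mathcal{C}=\{j\in\mathcal{A}:\zeta_j=1\}$, and assume $\mathcal{A}=\mathcal{S}\cup\mathcal{C}$. Let $M$ be the submatrix of $\mathcal{H}_K(\boldsymbol{\tau})^{-1}$ formed by the rows and columns indexed by $\mathcal{C}$. Then, as $n\to+\infty$, \[ \mathbb{P}(m \text{ is an } \boldsymbol{\alpha}\text{-winner}) \sim \frac{P(\boldsymbol{\zeta})^n}{\prod_{j\in\mathcal{S}}\big((1-\zeta_j)\zeta_j^{\lceil\beta_j n\rceil-1}\big)}\cdot\frac{1}{\sqrt{(2\pi)^{m-1}n^{|\mathcal{S}|}\det(\mathcal{H}_K(\boldsymbol{\tau}))}}\int_{(0,+\infty)^{|\mathcal{C}|}}e^{-\mathbf{u}^TM\mathbf{u}/2}\,d\mathbf{u}. \]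
   Context: Fix an integer $m\ge 2$ of candidates $\{1,\dots,m\}$ and let $\mathcal{A}=\{1,\dots,m-1\}$. There are $n$ voters; each voter independently draws a strict ranking $r$ of the candidates with probability $p_r$, where $p_r>0$ for each of the $m!$ rankings and $\sum_r p_r=1$ (independent of $n$). For $\mathcal{X}\subseteq\mathcal{A}$, let $p_{\mathcal{X}}$ be the probability that, in a random ranking, the set of adversaries ranked above $m$ is exactly $\mathcal{X}$; let $P(\mathbf{x})=\sum_{\mathcal{X}\subseteq\mathcal{A}} p_{\mathcal{X}}\prod_{j\in\mathcal{X}}x_j$. Fix $\boldsymbol{\alpha}\in(0,1)^{m-1}$, $\boldsymbol{\beta}=\mathbf{1}-\boldsymbol{\alpha}$. Candidate $m$ is an $\boldsymbol{\alpha}$-winner if for every $j\in\mathcal{A}$, strictly more than $\alpha_j n$ voters rank $m$ above $j$. Let $K(\mathbf{t})=\log P(e^{t_1},\dots,e^{t_{m-1}})$; $\boldsymbol{\tau}$ is the unique maximizer over $\mathbb{R}^{m-1}$ of $-K(\mathbf{t})+\boldsymbol{\beta}^T\mathbf{t}$, $\boldsymbol{\zeta}=e^{\boldsymbol{\tau}}$ componentwise, and $\mathcal{H}_K(\boldsymbol{\tau})$ is the Hessian of $K$ at $\boldsymbol{\tau}$. When $\mathcal{C}=\emptyset$ the integral is interpreted as $1$. *)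

theory Defs
  imports "HOL-Analysis.Analysis" "HOL-Library.Landau_Symbols"
begin

text \<open>Candidates are modelled by the type 'a option: None is the distinguished
candidate m, and Some j (j :: 'a) are the adversaries, so m - 1 = CARD('a).
A ranking is a rank function r onto positions {0..<m}; position 0 is the top,
so candidate x is ranked above y iff r x < r y.\<close>

definition rankings :: "('a::finite option \<Rightarrow> nat) set" where
  "rankings = {r. bij_betw r UNIV {..<CARD('a option)}}"

definition above_set :: "('a::finite option \<Rightarrow> nat) \<Rightarrow> 'a set" where
  "above_set r = {j. r (Some j) < r None}"

definition pX :: "(('a::finite option \<Rightarrow> nat) \<Rightarrow> real) \<Rightarrow> 'a set \<Rightarrow> real" where
  "pX p X = (\<Sum>r\<in>{r\<in>rankings. above_set r = X}. p r)"

definition Ppoly :: "(('a::finite option \<Rightarrow> nat) \<Rightarrow> real) \<Rightarrow> real^'a \<Rightarrow> real" where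
  "Ppoly p x = (\<Sum>X\<in>Pow (UNIV::'a set). pX p X * (\<Prod>j\<in>X. x $ j))"

definition Kfun :: "(('a::finite option \<Rightarrow> nat) \<Rightarrow> real) \<Rightarrow> real^'a \<Rightarrow> real" where
  "Kfun p t = ln (Ppoly p (\<chi> j. exp (t $ j)))"

definition is_alpha_winner :: "real^'a \<Rightarrow> nat \<Rightarrow> (nat \<Rightarrow> 'a::finite option \<Rightarrow> nat) \<Rightarrow> bool" where
  "is_alpha_winner \<alpha> n v =
     (\<forall>j. real (card {i\<in>{..<n}. v i None < v i (Some j)}) > \<alpha> $ j * real n)"

definition prob_winner :: "(('a::finite option \<Rightarrow> nat) \<Rightarrow> real) \<Rightarrow> real^'a \<Rightarrow> nat \<Rightarrow> real" where
  "prob_winner p \<alpha> n =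
     (\<Sum>v\<in>PiE {..<n} (\<lambda>_. rankings).
        (\<Prod>i<n. p (v i)) * (if is_alpha_winner \<alpha> n v then 1 else 0))"

definition partial_deriv :: "(real^'a \<Rightarrow> real) \<Rightarrow> 'a::finite \<Rightarrow> real^'a \<Rightarrow> real" where
  "partial_deriv f j t = deriv (\<lambda>s. f (t + s *\<^sub>R axis j 1)) 0"

definition hessian :: "(real^'a \<Rightarrow> real) \<Rightarrow> real^'a \<Rightarrow> real^'a^'a::finite" where
  "hessian f t = (\<chi> i k. partial_deriv (\<lambda>x. partial_deriv f k x) i t)"

end

theory Submission
  imports Defs "HOL-Probability.Probability" "HOL-Real_Asymp.Real_Asymp"
begin

text \<open>Let \<open>B\<close> count, for each adversary, the voters ranking it above \<open>m\<close>; the event is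
  \<open>B \<le> c\<close> with \<open>c = \<lceil>\<beta> n\<rceil> - 1\<close>. Exponential tilting by \<open>\<zeta>\<close> moves the mean of \<open>B\<close> to \<open>n \<beta>\<close>, because the
  gradient of \<open>K\<close> vanishes at the maximiser, and turns the probability into
  \<open>P(\<zeta>)^n \<zeta>^(-c) \<Sum>\<^bsub>l \<ge> 0\<^esub> \<zeta>^l q\<^sub>n(c - l)\<close>, where \<open>q\<^sub>n\<close> is the tilted law of \<open>B\<close> and its covariance is the
  Hessian of \<open>K\<close>. Fourier inversion on the torus gives a local limit theorem for \<open>q\<^sub>n\<close>. In the
  coordinates of \<open>S\<close> the sum is a geometric series; in those of \<open>C\<close> it is a Riemann sum of mesh
  \<open>1 / sqrt n\<close> for the Gaussian integral. Both limits are taken by a single application of dominated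
  convergence; the dominating function comes from a further tilt of size \<open>1 / sqrt n\<close> in the
  \<open>C\<close>-coordinates.\<close>

subsection \<open>Linear change of variables\<close>

text \<open>Two uniformity problems shape the proof. The local limit theorem needs control of the
  characteristic function on the whole cube \<open>[-pi, pi]\<close>, not only near 0. Some ranking
  puts nobody above m and, for each j, some ranking puts exactly j above m; the indicator vectors
  therefore differ by every unit vector, and this gives a Gaussian bound on the full cube with an
  explicit constant. The second problem sits in \<open>C\<close>: there \<open>\<zeta>\<close> is 1,
  the tilt gives no decay, and a uniform bound of order \<open>n powr (-d/2)\<close> (with d
  adversaries) cannot be summed over the roughly \<open>n ^ card C\<close> lattice points. The
  further tilt supplies the decay, but its weights vary with \<open>n\<close>; hence the Fourier
  bounds are stated with a constant that depends on the weights only through a lower bound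
  \<open>\<epsilon>\<close>. Rounding does no harm: \<open>c\<close> differs from
  \<open>n \<beta>\<close> by at most 1, which is invisible on the scale \<open>sqrt n\<close>, so
  the ceilings survive only in the powers of \<open>\<zeta>\<close>.\<close>

lemma borel_measurable_vec_lambda [measurable (raw)]:
  fixes f :: "'b \<Rightarrow> 'a::finite \<Rightarrow> real"
  assumes [measurable]: "\<And>i. (\<lambda>x. f x i) \<in> borel_measurable M"
  shows "(\<lambda>x. \<chi> i. f x i) \<in> borel_measurable M"
  by (subst borel_measurable_euclidean_space) (auto simp: Basis_vec_def inner_axis)

text \<open>Lebesgue measure is determined by the volumes of boxes, and here they are products of
  side lengths. The identification makes Fubini available one coordinate at a time on
  \<open>real^'a\<close>.\<close>

lemma lborel_vec_eq_distr_PiM: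
  "(lborel :: (real^'a::finite) measure) = distr (\<Pi>\<^sub>M i\<in>UNIV. lborel) borel (\<lambda>f. \<chi> i. f i)"
proof (rule lborel_eqI)
  interpret product_sigma_finite "\<lambda>_::'a. lborel :: real measure"
    by standard
  have meas [measurable]: "(\<lambda>f. \<chi> i. f i) \<in> (\<Pi>\<^sub>M i\<in>(UNIV::'a set). (lborel::real measure)) \<rightarrow>\<^sub>M borel"
    by measurable
  fix l u :: "real^'a" assume le: "\<And>b. b \<in> Basis \<Longrightarrow> l \<bullet> b \<le> u \<bullet> b"
  have le': "l $ i \<le> u $ i" for i
    using le[of "axis i 1"] by (simp add: inner_axis axis_in_Basis_iff)
  have eq: "(\<lambda>f. \<chi> i. f i) -` box l u \<inter> space (\<Pi>\<^sub>M i\<in>(UNIV::'a set). (lborel::real measure))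
      = (\<Pi>\<^sub>E i\<in>UNIV. {l $ i <..< u $ i})"
    by (auto simp: space_PiM mem_box_cart PiE_def Pi_def)
  have "emeasure (distr (\<Pi>\<^sub>M i\<in>UNIV. lborel) borel (\<lambda>f. \<chi> i. f i)) (box l u) = (\<Prod>i\<in>UNIV. emeasure lborel {l $ i <..< u $ i})"
    by (subst emeasure_distr) (auto simp only: eq meas intro!: emeasure_PiM, auto)
  also have "\<dots> = (\<Prod>i\<in>UNIV. ennreal ((u - l) $ i))"
    using le' by simp
  also have "\<dots> = ennreal (\<Prod>i\<in>UNIV. (u - l) $ i)"
    using le' by (intro prod_ennreal) auto
  also have "(\<Prod>i\<in>UNIV. (u - l) $ i) = (\<Prod>b\<in>Basis. (u - l) \<bullet> b)"
    by (rule prod.reindex_bij_witness[where i="\<lambda>b. axis_index b" and j="\<lambda>i. axis i 1"])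
       (auto simp: inner_axis axis_in_Basis_iff axis_index_axis Basis_vec_def)
  finally show "emeasure (distr (\<Pi>\<^sub>M i\<in>UNIV. lborel) borel (\<lambda>f. \<chi> i. f i)) (box l u)
      = ennreal (\<Prod>b\<in>Basis. (u - l) \<bullet> b)" .
qed simp

lemma integral_vec_prod:
  fixes f :: "'a::finite \<Rightarrow> real \<Rightarrow> 'b::{real_normed_field,banach,second_countable_topology}"
  assumes "\<And>i. integrable lborel (f i)"
  shows "integrable lborel (\<lambda>x::real^'a. \<Prod>i\<in>UNIV. f i (x $ i))"
    and "(\<integral>x. (\<Prod>i\<in>UNIV. f i ((x::real^'a) $ i)) \<partial>lborel) = (\<Prod>i\<in>UNIV. \<integral>y. f i y \<partial>lborel)"
proof -
  interpret product_sigma_finite "\<lambda>_::'a. lborel :: real measure"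
    by standard
  have [measurable]: "f i \<in> borel_measurable borel" for i
    using assms[of i] by (auto dest: borel_measurable_integrable)
  show "integrable lborel (\<lambda>x::real^'a. \<Prod>i\<in>UNIV. f i (x $ i))"
    unfolding lborel_vec_eq_distr_PiM
    by (subst integrable_distr_eq) (auto intro!: product_integrable_prod assms)
  show "(\<integral>x. (\<Prod>i\<in>UNIV. f i ((x::real^'a) $ i)) \<partial>lborel) = (\<Prod>i\<in>UNIV. \<integral>y. f i y \<partial>lborel)"
    unfolding lborel_vec_eq_distr_PiM
    by (subst integral_distr) (auto intro!: product_integral_prod assms)
qed

text \<open>Integrate coordinate \<open>m\<close> innermost: with the others frozen, the shear
  translates it by \<open>c * x $ n\<close>, which is constant because \<open>m \<noteq> n\<close>,
  and one-dimensional Lebesgue measure is translation invariant.\<close>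

lemma distr_lborel_shear:
  fixes m n :: "'a::finite"
  assumes "m \<noteq> n"
  shows "distr lborel borel (\<lambda>x::real^'a. \<chi> i. if i = m then x $ m + c * x $ n else x $ i) = lborel"
    (is "distr _ _ ?T = _")
proof (rule measure_eqI)
  interpret product_sigma_finite "\<lambda>_::'a. lborel :: real measure"
    by standard
  have [measurable]: "?T \<in> borel_measurable borel"
    by measurable
  let ?I = "UNIV - {m}" and ?V = "\<lambda>f::'a \<Rightarrow> real. (\<chi> i. f i)"
  have UN: "insert m ?I = UNIV" by auto
  have mV [measurable]: "?V \<in> (\<Pi>\<^sub>M i\<in>insert m ?I. (lborel::real measure)) \<rightarrow>\<^sub>M borel"
    unfolding UN by measurable
  have split: "(\<integral>\<^sup>+x. g x \<partial>lborel) = (\<integral>\<^sup>+f. (\<integral>\<^sup>+y. g (?V (f(m := y))) \<partial>lborel) \<partial>(\<Pi>\<^sub>M i\<in>?I. lborel))"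
    if [measurable]: "g \<in> borel_measurable borel" for g :: "real^'a \<Rightarrow> ennreal"
  proof -
    have "(\<integral>\<^sup>+x. g x \<partial>lborel) = (\<integral>\<^sup>+f. g (?V f) \<partial>(\<Pi>\<^sub>M i\<in>insert m ?I. lborel))"
      unfolding UN by (subst lborel_vec_eq_distr_PiM, subst nn_integral_distr) auto
    also have "\<dots> = (\<integral>\<^sup>+f. (\<integral>\<^sup>+y. g (?V (f(m := y))) \<partial>lborel) \<partial>(\<Pi>\<^sub>M i\<in>?I. lborel))"
      by (rule product_nn_integral_insert) auto
    finally show ?thesis .
  qed
  fix A assume "A \<in> sets (distr lborel borel ?T)"
  then have [measurable]: "A \<in> sets borel" by simp
  have mf: "(\<lambda>y. ?V (f(m := y))) \<in> borel_measurable borel" for f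
    by (intro borel_measurable_vec_lambda) (auto simp: fun_upd_def)
  have "emeasure (distr lborel borel ?T) A = (\<integral>\<^sup>+x. indicator A x \<partial>distr lborel borel ?T)"
    by simp
  also have "\<dots> = (\<integral>\<^sup>+x. indicator A (?T x) \<partial>lborel)"
    by (subst nn_integral_distr) auto
  also have "\<dots> = (\<integral>\<^sup>+f. (\<integral>\<^sup>+y. indicator A (?T (?V (f(m := y)))) \<partial>lborel) \<partial>(\<Pi>\<^sub>M i\<in>?I. lborel))"
    by (rule split) auto
  also have "\<dots> = (\<integral>\<^sup>+f. (\<integral>\<^sup>+y. indicator A (?V (f(m := y))) \<partial>lborel) \<partial>(\<Pi>\<^sub>M i\<in>?I. lborel))"
  proof (rule nn_integral_cong)
    fix f :: "'a \<Rightarrow> real"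
    have T: "?T (?V (f(m := y))) = ?V (f(m := c * f n + 1 * y))" for y
      using assms by (auto simp: vec_eq_iff)
    have "(\<integral>\<^sup>+y. indicator A (?V (f(m := y))) \<partial>lborel)
        = ennreal \<bar>1\<bar> * (\<integral>\<^sup>+y. indicator A (?V (f(m := c * f n + 1 * y))) \<partial>lborel)"
      by (rule nn_integral_real_affine) (auto intro!: measurable_compose[OF mf])
    then show "(\<integral>\<^sup>+y. indicator A (?T (?V (f(m := y)))) \<partial>lborel) = (\<integral>\<^sup>+y. indicator A (?V (f(m := y))) \<partial>lborel)"
      unfolding T by (simp only: abs_one ennreal_1 mult_1_left)
  qed
  also have "\<dots> = (\<integral>\<^sup>+x. indicator A x \<partial>lborel)"
    by (rule split[symmetric]) auto
  finally show "emeasure (distr lborel borel ?T) A = emeasure lborel A" by simp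
qed simp

text \<open>The library proves this change of variables only for index types of class \<open>wellorder\<close>.\<close>

lemma lborel_density_distr_matrix:
  fixes A :: "real^'a^'a::finite"
  assumes "det A \<noteq> 0"
  shows "lborel = density (distr lborel borel ((*v) A)) (\<lambda>_. ennreal \<bar>det A\<bar>)"
proof -
  have meas [measurable]: "(*v) B \<in> borel_measurable borel" for B :: "real^'a^'a"
    by (intro borel_measurable_continuous_onI linear_continuous_on)
       (simp add: matrix_vector_mul_bounded_linear)
  \<comment> \<open>The hypothesis is part of the induction formula: the case of a zero row becomes
    vacuous, and both factors of an invertible product are again invertible.\<close>
  have "det A \<noteq> 0 \<longrightarrow> lborel = density (distr lborel borel ((*v) A)) (\<lambda>_. ennreal \<bar>det A\<bar>)"
  proof (induction A rule: induct_matrix_elementary[case_names mult zero_row diagonal swap1 idplus])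
    case (mult A B)
    show ?case
    proof
      assume nz: "det (A ** B) \<noteq> 0"
      then have "det A \<noteq> 0" "det B \<noteq> 0" by (auto simp: det_mul)
      with mult have A: "lborel = density (distr lborel borel ((*v) A)) (\<lambda>_. ennreal \<bar>det A\<bar>)"
        and B: "lborel = density (distr lborel borel ((*v) B)) (\<lambda>_. ennreal \<bar>det B\<bar>)" by auto
      have comp: "(*v) (A ** B) = (*v) A \<circ> (*v) B"
        by (auto simp: matrix_vector_mul_assoc)
      have "distr lborel borel ((*v) A)
          = distr (density (distr lborel borel ((*v) B)) (\<lambda>_. ennreal \<bar>det B\<bar>)) borel ((*v) A)"
        using B by simp
      also have "\<dots> = density (distr (distr lborel borel ((*v) B)) borel ((*v) A)) (\<lambda>_. ennreal \<bar>det B\<bar>)"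
        by (subst density_distr) auto
      also have "distr (distr lborel borel ((*v) B)) borel ((*v) A) = distr lborel borel ((*v) (A ** B))"
        unfolding comp by (subst distr_distr) auto
      finally have "density (distr lborel borel ((*v) A)) (\<lambda>_. ennreal \<bar>det A\<bar>)
          = density (density (distr lborel borel ((*v) (A ** B))) (\<lambda>_. ennreal \<bar>det B\<bar>)) (\<lambda>_. ennreal \<bar>det A\<bar>)"
        by simp
      also have "\<dots> = density (distr lborel borel ((*v) (A ** B))) (\<lambda>_. ennreal \<bar>det (A ** B)\<bar>)"
        by (subst density_density_eq) (auto simp: det_mul abs_mult ennreal_mult'' mult.commute)
      finally show "lborel = density (distr lborel borel ((*v) (A ** B))) (\<lambda>_. ennreal \<bar>det (A ** B)\<bar>)"
        using A by simp
    qed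
  next
    case (zero_row A i)
    then show ?case using det_zero_row(1)[of i A] by (simp add: row_def vec_eq_iff)
  next
    case (diagonal A)
    show ?case
    proof
      assume nz: "det A \<noteq> 0"
      have dA: "det A = (\<Prod>i\<in>UNIV. A $ i $ i)"
        by (rule det_diagonal) (use diagonal in auto)
      define c where "c = (\<lambda>b::real^'a. A $ axis_index b $ axis_index b)"
      have reindex: "(\<Prod>b\<in>Basis. \<bar>c b\<bar>) = (\<Prod>i\<in>UNIV. \<bar>A $ i $ i\<bar>)"
        by (rule prod.reindex_bij_witness[where j="\<lambda>b. axis_index b" and i="\<lambda>i. axis i 1"])
           (auto simp: c_def axis_in_Basis_iff axis_index_axis Basis_vec_def)
      have "c b \<noteq> 0" if "b \<in> Basis" for b
        using nz by (auto simp: dA c_def)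
      from lborel_affine_euclidean[OF this, where t=0]
      have L: "lborel = density (distr lborel borel (\<lambda>x. 0 + (\<Sum>j\<in>Basis. (c j * (x \<bullet> j)) *\<^sub>R j))) (\<lambda>_. \<Prod>j\<in>Basis. \<bar>c j\<bar>)"
        by simp
      have "A *v x = 0 + (\<Sum>j\<in>Basis. (c j * (x \<bullet> j)) *\<^sub>R j)" for x
      proof -
        have "(\<Sum>j\<in>Basis. (c j * (x \<bullet> j)) *\<^sub>R j) = (\<Sum>i\<in>UNIV. (A $ i $ i * x $ i) *\<^sub>R axis i 1)"
          by (rule sum.reindex_bij_witness[where j="\<lambda>b. axis_index b" and i="\<lambda>i. axis i 1"])
             (auto simp: c_def axis_in_Basis_iff axis_index_axis Basis_vec_def inner_axis)
        moreover have "(A *v x) $ k = (\<Sum>i\<in>UNIV. (A $ i $ i * x $ i) *\<^sub>R axis i 1) $ k" for k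
        proof -
          have "A $ k $ j * x $ j = (if j = k then A $ k $ k * x $ k else 0)" for j
            using diagonal[of k j] by auto
          then have "(A *v x) $ k = (\<Sum>j\<in>UNIV. if j = k then A $ k $ k * x $ k else 0)"
            unfolding matrix_vector_mult_def vec_lambda_beta by (intro sum.cong refl)
          moreover have "(\<Sum>i\<in>UNIV. (A $ i $ i * x $ i) *\<^sub>R axis i 1) $ k = (\<Sum>j\<in>UNIV. if j = k then A $ k $ k * x $ k else 0)"
            unfolding sum_component by (intro sum.cong) (auto simp: axis_def)
          ultimately show ?thesis by simp
        qed
        ultimately show ?thesis by (simp add: vec_eq_iff)
      qed
      then have "(*v) A = (\<lambda>x. 0 + (\<Sum>j\<in>Basis. (c j * (x \<bullet> j)) *\<^sub>R j))" by auto
      then show "lborel = density (distr lborel borel ((*v) A)) (\<lambda>_. ennreal \<bar>det A\<bar>)"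
        using L unfolding dA abs_prod reindex by simp
    qed
  next
    case (swap1 m n)
    let ?\<pi> = "Transposition.transpose m n"
    let ?A = "(\<chi> i j. mat 1 $ i $ ?\<pi> j) :: real^'a^'a"
    have \<pi>: "i = ?\<pi> j \<longleftrightarrow> j = ?\<pi> i" for i j
      by (metis transpose_involutory)
    have det: "\<bar>det ?A\<bar> = 1"
      by (subst det_permute_columns) (auto simp: permutes_swap_id sign_swap_id abs_mult)
    have Av: "?A *v x = (\<chi> i. x $ ?\<pi> i)" for x
    proof -
      have "mat 1 $ i $ ?\<pi> j * x $ j = (if j = ?\<pi> i then x $ ?\<pi> i else 0)" for i j
        using \<pi>[of i j] by (simp add: mat_def)
      then have "(?A *v x) $ i = (\<Sum>j\<in>UNIV. if j = ?\<pi> i then x $ ?\<pi> i else 0)" for i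
        unfolding matrix_vector_mult_def vec_lambda_beta by (intro sum.cong refl)
      then show ?thesis by (simp add: vec_eq_iff)
    qed
    have "lborel = distr lborel borel ((*v) ?A)"
    proof (rule lborel_eqI)
      fix l u :: "real^'a" assume le: "\<And>b. b \<in> Basis \<Longrightarrow> l \<bullet> b \<le> u \<bullet> b"
      have le': "l $ i \<le> u $ i" for i
        using le[of "axis i 1"] by (simp add: inner_axis axis_in_Basis_iff)
      let ?l = "\<chi> i. l $ ?\<pi> i" and ?u = "\<chi> i. u $ ?\<pi> i"
      have reidx: "(\<Prod>b\<in>Basis. (v::real^'a) \<bullet> b) = (\<Prod>i\<in>UNIV. v $ i)" for v
        by (rule prod.reindex_bij_witness[where j="\<lambda>b. axis_index b" and i="\<lambda>i. axis i 1"])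
           (auto simp: inner_axis axis_in_Basis_iff axis_index_axis Basis_vec_def)
      have box: "(*v) ?A -` box l u = box ?l ?u"
      proof (rule set_eqI)
        fix x
        have "(\<forall>i. l $ i < x $ ?\<pi> i \<and> x $ ?\<pi> i < u $ i) \<longleftrightarrow> (\<forall>i. l $ ?\<pi> i < x $ i \<and> x $ i < u $ ?\<pi> i)"
          by (metis transpose_involutory)
        then show "x \<in> (*v) ?A -` box l u \<longleftrightarrow> x \<in> box ?l ?u"
          by (simp add: Av mem_box_cart)
      qed
      have "emeasure (distr lborel borel ((*v) ?A)) (box l u) = emeasure lborel (box ?l ?u)"
        by (subst emeasure_distr) (auto simp: box[symmetric])
      also have "\<dots> = ennreal (\<Prod>b\<in>Basis. (?u - ?l) \<bullet> b)"
        by (subst emeasure_lborel_box) (auto simp: Basis_vec_def inner_axis le')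
      also have "\<dots> = ennreal (\<Prod>b\<in>Basis. (u - l) \<bullet> b)"
        unfolding reidx using prod.permute[OF permutes_swap_id[of m UNIV n], of "\<lambda>i. (u - l) $ i"]
        by simp
      finally show "emeasure (distr lborel borel ((*v) ?A)) (box l u) = ennreal (\<Prod>b\<in>Basis. (u - l) \<bullet> b)" .
    qed simp
    then show ?case using det by (simp add: density_1)
  next
    case (idplus m n c)
    let ?A = "(\<chi> i j. if i = m \<and> j = n then c else of_bool (i = j)) :: real^'a^'a"
    have "?A = (\<chi> k. if k = m then row m (mat 1) + c *s row n (mat 1) else row k (mat 1))"
      using idplus by (auto simp: vec_eq_iff row_def mat_def)
    then have det: "det ?A = 1"
      using det_row_operation[OF idplus, of "mat 1" c] by simp
    have Av: "?A *v x = (\<chi> i. if i = m then x $ m + c * x $ n else x $ i)" for x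
    proof -
      have "(?A *v x) $ i = (if i = m then x $ m + c * x $ n else x $ i)" for i
      proof (cases "i = m")
        case True
        have "(?A *v x) $ i = (\<Sum>j\<in>UNIV. (if j = m then x $ m else 0) + (if j = n then c * x $ n else 0))"
          unfolding matrix_vector_mult_def using True idplus by (auto intro!: sum.cong)
        then show ?thesis using True by (simp add: sum.distrib)
      next
        case False
        have "(?A *v x) $ i = (\<Sum>j\<in>UNIV. (if j = i then x $ i else 0))"
          unfolding matrix_vector_mult_def using False by (auto intro!: sum.cong)
        then show ?thesis using False by simp
      qed
      then show ?thesis by (simp add: vec_eq_iff)
    qed
    then have "(*v) ?A = (\<lambda>x. \<chi> i. if i = m then x $ m + c * x $ n else x $ i)" by auto
    then show ?case using det distr_lborel_shear[OF idplus, of c] by (simp add: density_1)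
  qed
  with assms show ?thesis by blast
qed

lemma matrix_substitution_lborel:
  fixes A :: "real^'a^'a::finite" and f :: "real^'a \<Rightarrow> 'b::{banach,second_countable_topology}"
  assumes "det A \<noteq> 0" and [measurable]: "f \<in> borel_measurable borel"
  shows "integrable lborel f \<longleftrightarrow> integrable lborel (\<lambda>x. f (A *v x))"
    and "(\<integral>x. f x \<partial>lborel) = \<bar>det A\<bar> *\<^sub>R (\<integral>x. f (A *v x) \<partial>lborel)"
proof -
  have [measurable]: "(*v) A \<in> borel_measurable borel"
    by (intro borel_measurable_continuous_onI linear_continuous_on)
       (simp add: matrix_vector_mul_bounded_linear)
  have "integrable lborel f \<longleftrightarrow> integrable lborel (\<lambda>x. \<bar>det A\<bar> *\<^sub>R f (A *v x))"
    by (subst lborel_density_distr_matrix[OF assms(1)], subst integrable_density)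
       (auto simp: integrable_distr_eq)
  also have "\<dots> \<longleftrightarrow> integrable lborel (\<lambda>x. f (A *v x))"
    using assms(1) integrable_scaleR_right[of "1 / \<bar>det A\<bar>" lborel "\<lambda>x. \<bar>det A\<bar> *\<^sub>R f (A *v x)"]
    by auto
  finally show "integrable lborel f \<longleftrightarrow> integrable lborel (\<lambda>x. f (A *v x))" .
  show "(\<integral>x. f x \<partial>lborel) = \<bar>det A\<bar> *\<^sub>R (\<integral>x. f (A *v x) \<partial>lborel)"
    by (subst lborel_density_distr_matrix[OF assms(1)], subst integral_density)
       (auto simp: integral_distr)
qed

subsection \<open>Gaussian Fourier integrals\<close>

text \<open>Gram-Schmidt for the inner product \<open>u \<bullet> (H *v v)\<close>: the columns of
  \<open>W\<close> form an orthonormal basis for it. The induction runs over finite sets of column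
  indices, since the index type carries no order.\<close>

lemma exists_congruence_to_identity:
  fixes H :: "real^'a^'a::finite"
  assumes sym: "transpose H = H" and pos: "\<And>v. v \<noteq> 0 \<Longrightarrow> 0 < v \<bullet> (H *v v)"
  obtains W :: "real^'a^'a" where "transpose W ** H ** W = mat 1"
proof -
  have symB: "u \<bullet> (H *v v) = v \<bullet> (H *v u)" for u v
    by (metis dot_lmul_matrix inner_commute sym transpose_matrix_vector)
  have "\<exists>b::'a \<Rightarrow> real^'a. \<forall>i\<in>F. \<forall>j\<in>F. b i \<bullet> (H *v b j) = of_bool (i = j)" for F :: "'a set"
  proof (induction F rule: finite_induct[OF finite])
    case (2 k F)
    then obtain b where b: "\<And>i j. i \<in> F \<Longrightarrow> j \<in> F \<Longrightarrow> b i \<bullet> (H *v b j) = of_bool (i = j)"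
      by blast
    \<comment> \<open>Fewer than \<open>CARD('a)\<close> vectors cannot span, so there is a
      \<open>v\<close> outside their span, and its component orthogonal to them is nonzero.\<close>
    have "dim (span (b ` F)) \<le> card (b ` F)"
      by (simp add: dim_le_card')
    also have "\<dots> \<le> card F"
      by (simp add: card_image_le)
    also have "\<dots> < CARD('a)"
      using 2 by (intro psubset_card_mono) auto
    also have "\<dots> = dim (UNIV :: (real^'a) set)"
      by simp
    finally have "span (b ` F) \<noteq> UNIV" by force
    then obtain v where v: "v \<notin> span (b ` F)" by blast
    define w where "w = v - (\<Sum>i\<in>F. (b i \<bullet> (H *v v)) *\<^sub>R b i)"
    have "w \<noteq> 0"
    proof
      assume "w = 0"
      then have "v = (\<Sum>i\<in>F. (b i \<bullet> (H *v v)) *\<^sub>R b i)" by (simp add: w_def)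
      also have "\<dots> \<in> span (b ` F)"
        by (intro span_sum span_scale span_base) auto
      finally show False using v by simp
    qed
    then have w_pos: "0 < w \<bullet> (H *v w)" by (rule pos)
    have lin: "linear (\<lambda>v. b j \<bullet> (H *v v))" for j
      by (intro linearI) (simp_all add: matrix_vector_right_distrib inner_add_right matrix_vector_mult_scaleR)
    have orth: "b j \<bullet> (H *v w) = 0" if "j \<in> F" for j
    proof -
      have "b j \<bullet> (H *v w) = b j \<bullet> (H *v v) - (\<Sum>i\<in>F. (b i \<bullet> (H *v v)) * (b j \<bullet> (H *v b i)))"
        unfolding w_def by (simp add: linear_diff[OF lin] linear_sum[OF lin] linear_scale[OF lin])
      also have "(\<Sum>i\<in>F. (b i \<bullet> (H *v v)) * (b j \<bullet> (H *v b i))) = (\<Sum>i\<in>F. if i = j then b j \<bullet> (H *v v) else 0)"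
        using that b by (intro sum.cong) auto
      finally show ?thesis using that 2 by simp
    qed
    let ?c = "inverse (sqrt (w \<bullet> (H *v w)))"
    define b' where "b' = b(k := ?c *\<^sub>R w)"
    have "b' i \<bullet> (H *v b' j) = of_bool (i = j)" if "i \<in> insert k F" "j \<in> insert k F" for i j
    proof -
      have n: "(?c *\<^sub>R w) \<bullet> (H *v (?c *\<^sub>R w)) = 1"
        using w_pos by (simp add: matrix_vector_mult_scaleR field_simps)
      have "(?c *\<^sub>R w) \<bullet> (H *v b j) = 0" "b j \<bullet> (H *v (?c *\<^sub>R w)) = 0" if "j \<in> F" for j
        using orth[OF that] symB[of "b j" w] by (simp_all add: matrix_vector_mult_scaleR)
      with n that 2 b show ?thesis by (auto simp: b'_def)
    qed
    then show ?case by blast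
  qed simp
  from this[of UNIV] obtain b :: "'a \<Rightarrow> real^'a"
    where b: "\<And>i j. b i \<bullet> (H *v b j) = of_bool (i = j)" by auto
  define W where "W = (\<chi> r c. b c $ r)"
  have "(transpose W ** H ** W) $ i $ j = of_bool (i = j)" for i j
  proof -
    have "(transpose W ** (H ** W)) $ i $ j = b i \<bullet> (H *v b j)"
      by (simp add: matrix_matrix_mult_def transpose_def W_def inner_vec_def matrix_vector_mult_def)
    then show ?thesis using b by (simp add: matrix_mul_assoc)
  qed
  then have "transpose W ** H ** W = mat 1"
    by (auto simp: vec_eq_iff mat_def)
  then show ?thesis by (rule that)
qed

lemma cis_sum: "cis (\<Sum>i\<in>A. f i) = (\<Prod>i\<in>A. cis (f i))"
  by (induction A rule: infinite_finite_induct) (auto simp: cis_mult[symmetric])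

text \<open>Up to the factor \<open>sqrt (2 * pi)\<close> this is the characteristic function of the
  standard normal law at \<open>- t\<close>.\<close>

lemma integral_gaussian_cis:
  "integrable lborel (\<lambda>x. complex_of_real (exp (- x\<^sup>2 / 2)) * cis (- (x * t)))"
  "(\<integral>x. complex_of_real (exp (- x\<^sup>2 / 2)) * cis (- (x * t)) \<partial>lborel)
     = complex_of_real (sqrt (2 * pi) * exp (- t\<^sup>2 / 2))"
proof -
  have d: "std_normal_density x *\<^sub>R iexp (- t * x)
      = complex_of_real (1 / sqrt (2 * pi)) * (complex_of_real (exp (- x\<^sup>2 / 2)) * cis (- (x * t)))" for x
    by (simp add: std_normal_density_def scaleR_conv_of_real cis_conv_exp mult.commute)
  have "integrable lborel (\<lambda>x. std_normal_density x *\<^sub>R iexp (- t * x))"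
    by (rule Bochner_Integration.integrable_bound[where f=std_normal_density])
       (auto simp: norm_mult intro!: integrable_normal_moment[where k=0 and \<sigma>=1 and \<mu>=0, simplified])
  then have "integrable lborel (\<lambda>x. complex_of_real (sqrt (2 * pi)) * (std_normal_density x *\<^sub>R iexp (- t * x)))"
    by (rule integrable_mult_right)
  then show "integrable lborel (\<lambda>x. complex_of_real (exp (- x\<^sup>2 / 2)) * cis (- (x * t)))"
    unfolding d mult.assoc[symmetric] of_real_mult[symmetric] by simp
  have "complex_of_real (exp (- t\<^sup>2 / 2)) = char std_normal_distribution (- t)"
    by (simp add: char_std_normal_distribution)
  also have "\<dots> = (\<integral>x. std_normal_density x *\<^sub>R iexp (- t * x) \<partial>lborel)"
    unfolding char_def by (subst integral_density) auto
  also have "\<dots> = complex_of_real (1 / sqrt (2 * pi)) * (\<integral>x. complex_of_real (exp (- x\<^sup>2 / 2)) * cis (- (x * t)) \<partial>lborel)"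
    unfolding d by (rule integral_mult_right_zero)
  finally show "(\<integral>x. complex_of_real (exp (- x\<^sup>2 / 2)) * cis (- (x * t)) \<partial>lborel)
     = complex_of_real (sqrt (2 * pi) * exp (- t\<^sup>2 / 2))"
    by (simp add: field_simps)
qed

lemma integral_std_gaussian_vec_cis:
  fixes y :: "real^'a::finite"
  shows "integrable lborel (\<lambda>x::real^'a. complex_of_real (exp (- (x \<bullet> x) / 2)) * cis (- (x \<bullet> y)))"
  "(\<integral>x. complex_of_real (exp (- (x \<bullet> x) / 2)) * cis (- (x \<bullet> y)) \<partial>lborel)
     = complex_of_real (sqrt (2 * pi) ^ CARD('a) * exp (- (y \<bullet> y) / 2))"
proof -
  have prod: "complex_of_real (exp (- (x \<bullet> x) / 2)) * cis (- (x \<bullet> y))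
      = (\<Prod>i\<in>UNIV. complex_of_real (exp (- (x $ i)\<^sup>2 / 2)) * cis (- (x $ i * y $ i)))" for x :: "real^'a"
    by (simp add: inner_vec_def prod.distrib cis_sum exp_sum power2_eq_square
        sum_divide_distrib sum_distrib_left flip: of_real_prod sum_negf)
  show "integrable lborel (\<lambda>x::real^'a. complex_of_real (exp (- (x \<bullet> x) / 2)) * cis (- (x \<bullet> y)))"
    unfolding prod by (rule integral_vec_prod) (rule integral_gaussian_cis)
  have "(\<integral>x. complex_of_real (exp (- (x \<bullet> x) / 2)) * cis (- (x \<bullet> y)) \<partial>lborel)
     = (\<Prod>i\<in>UNIV. complex_of_real (sqrt (2 * pi) * exp (- (y $ i)\<^sup>2 / 2)))"
    unfolding prod by (subst integral_vec_prod) (simp_all only: integral_gaussian_cis)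
  also have "\<dots> = complex_of_real (sqrt (2 * pi) ^ CARD('a) * exp (- (y \<bullet> y) / 2))"
    by (simp add: inner_vec_def prod.distrib exp_sum power2_eq_square
        sum_divide_distrib flip: of_real_prod of_real_mult of_real_power sum_negf)
  finally show "(\<integral>x. complex_of_real (exp (- (x \<bullet> x) / 2)) * cis (- (x \<bullet> y)) \<partial>lborel)
     = complex_of_real (sqrt (2 * pi) ^ CARD('a) * exp (- (y \<bullet> y) / 2))" .
qed

text \<open>Substituting \<open>x = W z\<close> with \<open>W\<close> from the congruence turns the
  form into \<open>z \<bullet> z\<close> and the frequency into \<open>transpose W *v y\<close>. The
  two factors of the value come from \<open>\<bar>det W\<bar> = 1 / sqrt (det H)\<close> and from
  \<open>W ** transpose W\<close> being the inverse of \<open>H\<close>.\<close>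

lemma integral_gaussian_vec_cis:
  fixes H :: "real^'a^'a::finite" and y :: "real^'a"
  assumes sym: "transpose H = H" and pos: "\<And>v. v \<noteq> 0 \<Longrightarrow> 0 < v \<bullet> (H *v v)"
  shows "det H > 0"
    and "integrable lborel (\<lambda>x. complex_of_real (exp (- (x \<bullet> (H *v x)) / 2)) * cis (- (x \<bullet> y)))"
    and "(\<integral>x. complex_of_real (exp (- (x \<bullet> (H *v x)) / 2)) * cis (- (x \<bullet> y)) \<partial>lborel)
     = complex_of_real (sqrt ((2 * pi) ^ CARD('a)) / sqrt (det H) * exp (- (y \<bullet> (matrix_inv H *v y)) / 2))"
proof -
  obtain W :: "real^'a^'a" where W: "transpose W ** H ** W = mat 1"
    by (rule exists_congruence_to_identity[OF sym pos])
  have "det W * det H * det W = 1"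
    using arg_cong[OF W, of det] by (simp add: det_mul)
  then have dd: "(det W)\<^sup>2 * det H = 1" by (simp add: power2_eq_square algebra_simps)
  then have nz: "det W \<noteq> 0" by auto
  show dH: "det H > 0"
    using dd nz by (metis zero_less_mult_pos zero_less_one zero_less_power2)
  have detW: "\<bar>det W\<bar> = 1 / sqrt (det H)"
  proof -
    have "\<bar>det W\<bar> * sqrt (det H) = 1"
      using arg_cong[OF dd, of sqrt] by (simp add: real_sqrt_mult)
    then show ?thesis using dH by (simp add: field_simps)
  qed
  have adj: "(B *v x) \<bullet> z = x \<bullet> (transpose B *v z)" for B :: "real^'a^'a" and x z
    by (metis dot_lmul_matrix inner_commute transpose_matrix_vector)
  have quad: "(W *v x) \<bullet> (H *v (W *v x)) = x \<bullet> x" for x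
    using W by (simp add: adj[of W] matrix_vector_mul_assoc matrix_mul_assoc del: transpose_matrix_vector)
  have 1: "H ** (W ** transpose W) = mat 1"
    using W by (metis matrix_left_right_inverse matrix_mul_assoc)
  then have 2: "(W ** transpose W) ** H = mat 1"
    by (metis matrix_left_right_inverse)
  \<comment> \<open>\<open>matrix_inv\<close> is defined by choice, so an explicit two-sided inverse
    must be exhibited before it can be computed with.\<close>
  have "H ** matrix_inv H = mat 1 \<and> matrix_inv H ** H = mat 1"
    unfolding matrix_inv_def by (rule someI[of _ "W ** transpose W"]) (simp add: 1 2)
  then have inv: "matrix_inv H = W ** transpose W"
    by (metis 1 matrix_mul_assoc matrix_mul_lid matrix_mul_rid)
  have yy: "(transpose W *v y) \<bullet> (transpose W *v y) = y \<bullet> (matrix_inv H *v y)"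
    using adj[of "transpose W" y "transpose W *v y"]
    unfolding inv by (simp add: matrix_vector_mul_assoc transpose_transpose del: transpose_matrix_vector)
  let ?f = "\<lambda>x. complex_of_real (exp (- (x \<bullet> (H *v x)) / 2)) * cis (- (x \<bullet> y))"
  have "continuous_on UNIV (\<lambda>x. H *v x)"
    by (simp add: linear_continuous_on matrix_vector_mul_bounded_linear)
  then have meas: "?f \<in> borel_measurable borel"
    unfolding cis_conv_exp
    by (intro borel_measurable_continuous_onI continuous_intros) auto
  note subst = matrix_substitution_lborel[OF nz meas, unfolded quad, unfolded adj[of W]]
  show "integrable lborel ?f"
    using subst(1) integral_std_gaussian_vec_cis(1) by simp
  have "(\<integral>x. ?f x \<partial>lborel) = \<bar>det W\<bar> *\<^sub>R complex_of_real (sqrt (2 * pi) ^ CARD('a) * exp (- (y \<bullet> (matrix_inv H *v y)) / 2))"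
    using subst(2) unfolding integral_std_gaussian_vec_cis yy by simp
  then show "(\<integral>x. ?f x \<partial>lborel)
     = complex_of_real (sqrt ((2 * pi) ^ CARD('a)) / sqrt (det H) * exp (- (y \<bullet> (matrix_inv H *v y)) / 2))"
    unfolding real_sqrt_power by (simp add: detW scaleR_conv_of_real)
qed

subsection \<open>Fourier inversion for count vectors\<close>

lemma integral_lborel_scale_vec:
  fixes f :: "real^'a::finite \<Rightarrow> 'b::{banach,second_countable_topology}"
  assumes "s > 0" and [measurable]: "f \<in> borel_measurable borel"
  shows "(\<integral>x. f x \<partial>lborel) = s ^ CARD('a) *\<^sub>R (\<integral>x. f (s *\<^sub>R x) \<partial>lborel)"
proof -
  have "(\<integral>x. f x \<partial>lborel)
      = (\<integral>x. f x \<partial>density (distr lborel borel (\<lambda>x. 0 + s *\<^sub>R x)) (\<lambda>_. ennreal (\<bar>s\<bar> ^ DIM(real^'a))))"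
    using assms(1) by (subst lborel_affine[of s 0]) auto
  also have "\<dots> = s ^ CARD('a) *\<^sub>R (\<integral>x. f (s *\<^sub>R x) \<partial>lborel)"
    using assms(1) by (subst integral_density) (auto simp: integral_distr)
  finally show ?thesis .
qed

text \<open>The norm of the Gaussian Fourier integrand at frequency 0, with \<open>2 * c\<close>
  times the identity as its matrix.\<close>

lemma integrable_exp_neg_inner:
  fixes c :: real
  assumes "c > 0"
  shows "integrable lborel (\<lambda>x::real^'a::finite. exp (- c * (x \<bullet> x)))"
proof -
  let ?H = "mat (2 * c) :: real^'a^'a"
  have v: "?H *v x = (2 * c) *\<^sub>R x" for x :: "real^'a"
    by (simp add: vec_eq_iff matrix_vector_mult_def mat_def if_distrib if_distribR cong: if_cong)
  have "integrable lborel (\<lambda>x. complex_of_real (exp (- (x \<bullet> (?H *v x)) / 2)) * cis (- (x \<bullet> 0)))"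
    by (rule integral_gaussian_vec_cis) (use assms in \<open>auto simp: v\<close>)
  from integrable_norm[OF this] show ?thesis
    by (simp add: v norm_mult)
qed

text \<open>Orthogonality of characters: for \<open>m \<noteq> 0\<close> the antiderivative takes
  the same value at both ends of the period.\<close>

lemma integral_cis_period:
  fixes m :: int
  shows "integrable lborel (\<lambda>x. indicator {-pi..pi} x *\<^sub>R cis (x * of_int m))"
    and "(\<integral>x. indicator {-pi..pi} x *\<^sub>R cis (x * of_int m) \<partial>lborel) = (if m = 0 then 2 * complex_of_real pi else 0)"
proof -
  define F where "F = (\<lambda>x. if m = 0 then complex_of_real x else cis (x * of_int m) / (\<i> * of_int m))"
  have F: "(F has_vector_derivative cis (x * of_int m)) (at x within {-pi..pi})" for x
  proof (cases "m = 0")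
    case True
    then show ?thesis by (auto simp: F_def intro!: derivative_eq_intros)
  next
    case False
    have "((\<lambda>z. exp (\<i> * (z * of_int m)) / (\<i> * of_int m)) has_field_derivative exp (\<i> * (of_real x * of_int m)))
        (at (complex_of_real x))"
      using False by (auto intro!: derivative_eq_intros) (simp add: mult.commute[of _ \<i>])
    from has_vector_derivative_real_field[OF this] False show ?thesis
      by (simp add: F_def[abs_def] cis_conv_exp)
  qed
  have cont: "continuous_on {-pi..pi} (\<lambda>x. cis (x * of_int m))"
    by (intro continuous_intros)
  have "has_bochner_integral lborel (\<lambda>x. indicator {-pi..pi} x *\<^sub>R cis (x * of_int m)) (F pi - F (-pi))"
    by (rule has_bochner_integral_FTC_Icc[OF _ F cont]) auto
  moreover have "F pi - F (-pi) = (if m = 0 then 2 * complex_of_real pi else 0)"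
  proof (cases "m = 0")
    case False
    have "cis (pi * of_int m) = cis (- (pi * of_int m))"
      by (auto simp: complex_eq_iff sin_integer_2pi sin_times_pi_eq_0 mult.commute[of pi])
    with False show ?thesis by (simp add: F_def)
  qed (simp add: F_def)
  ultimately show "integrable lborel (\<lambda>x. indicator {-pi..pi} x *\<^sub>R cis (x * of_int m))"
    "(\<integral>x. indicator {-pi..pi} x *\<^sub>R cis (x * of_int m) \<partial>lborel) = (if m = 0 then 2 * complex_of_real pi else 0)"
    by (auto simp: has_bochner_integral_iff)
qed

section \<open>Laws of count vectors, their tilts and their Fourier inversion\<close>

definition counts :: "('r \<Rightarrow> 'a set) \<Rightarrow> nat \<Rightarrow> (nat \<Rightarrow> 'r) \<Rightarrow> 'a \<Rightarrow> nat" where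
  "counts A n v j = card {i\<in>{..<n}. j \<in> A (v i)}"

text \<open>For probability weights \<open>w\<close> this is the law of the count vector of
  \<open>n\<close> independent samples. The original weights and all their tilts share it through
  the parameter \<open>w\<close>; integer-valued \<open>k\<close> admits differences such as
  \<open>c n j - l j\<close>, which get weight 0 when negative.\<close>

definition count_weight :: "'r set \<Rightarrow> ('r \<Rightarrow> real) \<Rightarrow> ('r \<Rightarrow> 'a set) \<Rightarrow> nat \<Rightarrow> ('a \<Rightarrow> int) \<Rightarrow> real" where
  "count_weight \<Omega> w A n k =
     (\<Sum>v\<in>{v \<in> PiE {..<n} (\<lambda>_. \<Omega>). \<forall>j. int (counts A n v j) = k j}. \<Prod>i<n. w (v i))"

text \<open>Double counting of pairs of a voter and an adversary in its set. Hence a tilt of product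
  form sees a sample only through its counts.\<close>

lemma sum_over_counts:
  fixes A :: "'r \<Rightarrow> 'a::finite set" and f :: "'a \<Rightarrow> real"
  shows "(\<Sum>i<n. \<Sum>j\<in>A (v i). f j) = (\<Sum>j\<in>UNIV. f j * real (counts A n v j))"
proof -
  have "(\<Sum>i<n. \<Sum>j\<in>A (v i). f j) = (\<Sum>i<n. \<Sum>j\<in>UNIV. f j * of_bool (j \<in> A (v i)))"
    by (intro sum.cong refl sum.mono_neutral_cong_left) auto
  also have "\<dots> = (\<Sum>j\<in>UNIV. \<Sum>i<n. f j * of_bool (j \<in> A (v i)))"
    by (rule sum.swap)
  also have "\<dots> = (\<Sum>j\<in>UNIV. f j * real (counts A n v j))"
    by (simp add: counts_def sum_distrib_left[symmetric] sum_of_bool_eq Int_def)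
  finally show ?thesis .
qed

lemma count_weight_nonneg:
  assumes "\<And>r. r \<in> \<Omega> \<Longrightarrow> 0 \<le> w r"
  shows "0 \<le> count_weight \<Omega> w A n k"
  unfolding count_weight_def using assms by (intro sum_nonneg prod_nonneg) auto

text \<open>All samples in the fibre over \<open>k\<close> carry the same tilting factor, so it
  leaves the sum. Estimates for a tilted law thereby transfer to the original one.\<close>

lemma count_weight_tilt:
  fixes A :: "'r \<Rightarrow> 'a::finite set"
  shows "count_weight \<Omega> (\<lambda>r. w r * exp (\<Sum>j\<in>A r. t j) / Z) A n k
    = count_weight \<Omega> w A n k * exp (\<Sum>j\<in>UNIV. t j * of_int (k j)) / Z ^ n"
proof -
  have "(\<Prod>i<n. w (v i) * exp (\<Sum>j\<in>A (v i). t j) / Z)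
      = (\<Prod>i<n. w (v i)) * exp (\<Sum>j\<in>UNIV. t j * of_int (k j)) / Z ^ n"
    if k: "\<forall>j. int (counts A n v j) = k j" for v
  proof -
    have "(\<Sum>i<n. \<Sum>j\<in>A (v i). t j) = (\<Sum>j\<in>UNIV. t j * of_int (k j))"
      unfolding sum_over_counts using k by (metis of_int_of_nat_eq)
    then show ?thesis
      by (simp add: prod_dividef prod.distrib exp_sum[symmetric] del: exp_sum)
  qed
  then show ?thesis
    unfolding count_weight_def sum_distrib_right sum_divide_distrib by (intro sum.cong) auto
qed

text \<open>Expanding the \<open>n\<close>-th power gives one term per sample tuple, and each term
  is a product of one-dimensional characters with frequencies \<open>counts A n v j - k j\<close>.
  Orthogonality keeps exactly the tuples in the fibre over \<open>k\<close>.\<close>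

lemma count_weight_Fourier:
  fixes A :: "'r \<Rightarrow> 'a::finite set"
  assumes "finite \<Omega>"
  shows "complex_of_real ((2 * pi) ^ CARD('a) * count_weight \<Omega> w A n k)
    = (\<integral>\<theta>. indicator (cbox (\<chi> i. - pi) (\<chi> i. pi)) \<theta> *\<^sub>R
         ((\<Sum>r\<in>\<Omega>. of_real (w r) * cis (\<Sum>j\<in>A r. \<theta> $ j)) ^ n * cis (- (\<Sum>j\<in>UNIV. \<theta> $ j * of_int (k j)))) \<partial>(lborel :: (real^'a) measure))"
    (is "_ = (\<integral>\<theta>. ?f \<theta> \<partial>_)")
proof -
  let ?V = "PiE {..<n} (\<lambda>_. \<Omega>)"
  define g where "g = (\<lambda>v (\<theta>::real^'a). \<Prod>j\<in>UNIV. indicator {-pi..pi} (\<theta> $ j) *\<^sub>R cis (\<theta> $ j * of_int (int (counts A n v j) - k j)))"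
  have ind: "indicator (cbox (\<chi> i. - pi) (\<chi> i. pi)) \<theta> = (\<Prod>j\<in>UNIV. indicator {-pi..pi} (\<theta> $ j) :: real)" for \<theta> :: "real^'a"
    by (auto simp: indicator_def mem_box_cart prod_zero_iff)
  have f: "?f \<theta> = (\<Sum>v\<in>?V. of_real (\<Prod>i<n. w (v i)) * g v \<theta>)" for \<theta>
  proof -
    have "(\<Sum>r\<in>\<Omega>. of_real (w r) * cis (\<Sum>j\<in>A r. \<theta> $ j)) ^ n
        = (\<Sum>v\<in>?V. \<Prod>i<n. of_real (w (v i)) * cis (\<Sum>j\<in>A (v i). \<theta> $ j))"
      using prod_sum_PiE[of "{..<n}" "\<lambda>_. \<Omega>" "\<lambda>i r. of_real (w r) * cis (\<Sum>j\<in>A r. \<theta> $ j)"] assms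
      by simp
    also have "\<dots> = (\<Sum>v\<in>?V. of_real (\<Prod>i<n. w (v i)) * cis (\<Sum>j\<in>UNIV. \<theta> $ j * real (counts A n v j)))"
      by (simp add: prod.distrib cis_sum[symmetric] sum_over_counts)
    finally show ?thesis
      by (simp add: g_def ind sum_distrib_right sum_distrib_left scaleR_conv_of_real prod.distrib
          cis_sum[symmetric] cis_mult algebra_simps sum.distrib sum_subtractf)
  qed
  have gI: "integrable lborel (g v)" for v
    unfolding g_def by (rule integral_vec_prod) (rule integral_cis_period)
  have gv: "(\<integral>\<theta>. g v \<theta> \<partial>lborel) = (if \<forall>j. int (counts A n v j) = k j then complex_of_real ((2 * pi) ^ CARD('a)) else 0)" for v
    unfolding g_def by (subst integral_vec_prod) (auto simp only: integral_cis_period, auto simp: prod_zero_iff)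
  have "(\<integral>\<theta>. ?f \<theta> \<partial>lborel) = (\<Sum>v\<in>?V. of_real (\<Prod>i<n. w (v i)) * (\<integral>\<theta>. g v \<theta> \<partial>lborel))"
    unfolding f using gI by (subst Bochner_Integration.integral_sum) auto
  also have "\<dots> = complex_of_real ((2 * pi) ^ CARD('a) * count_weight \<Omega> w A n k)"
    using assms unfolding gv count_weight_def
    by (simp add: sum.inter_filter[symmetric] finite_PiE if_distrib sum_distrib_left mult.commute cong: if_cong)
  finally show ?thesis by simp
qed

text \<open>With \<open>y = t / 2\<close> and \<open>pi < 4\<close>, the cubic Maclaurin error of
  the sine is at most two thirds of \<open>\<bar>y\<bar>\<close>, so
  \<open>\<bar>sin y\<bar> \<ge> \<bar>y\<bar> / 3\<close> and
  \<open>cos t \<le> 1 - t\<^sup>2 / 18\<close>. As the squared norm is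
  \<open>2 + 2 * cos t\<close>, comparison with the square of the right-hand side yields the
  36.\<close>

lemma norm_one_plus_cis_le:
  assumes "\<bar>t\<bar> \<le> pi"
  shows "norm (1 + cis t) \<le> 2 - t\<^sup>2 / 36"
proof -
  have t: "t\<^sup>2 \<le> 16"
    using assms pi_less_4 power_mono[of "\<bar>t\<bar>" 4 2] by simp
  let ?y = "t / 2"
  have "\<bar>sin ?y - ?y\<bar> \<le> \<bar>?y\<bar> ^ 3 / 6"
    using Maclaurin_sin_bound[of ?y 3] by (simp add: eval_nat_numeral sin_coeff_def lessThan_Suc)
  also have "\<bar>?y\<bar> ^ 3 / 6 \<le> \<bar>?y\<bar> * (2 / 3)"
  proof -
    have "\<bar>?y\<bar> * (t\<^sup>2 / 24) \<le> \<bar>?y\<bar> * (2 / 3)"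
      using t by (intro mult_left_mono) auto
    then show ?thesis by (simp add: power3_eq_cube power2_eq_square abs_mult[symmetric])
  qed
  finally have "\<bar>?y\<bar> / 3 \<le> \<bar>sin ?y\<bar>" by linarith
  then have "(\<bar>?y\<bar> / 3)\<^sup>2 \<le> \<bar>sin ?y\<bar>\<^sup>2" by (rule power_mono) auto
  then have "t\<^sup>2 / 36 \<le> (sin ?y)\<^sup>2" by (simp add: power_divide)
  then have c: "cos t \<le> 1 - t\<^sup>2 / 18"
    using cos_double_sin[of ?y] by simp
  have "(norm (1 + cis t))\<^sup>2 = 2 + 2 * cos t"
    unfolding cmod_power2 using sin_cos_squared_add[of t] by (simp add: power2_eq_square algebra_simps)
  also have "\<dots> \<le> (2 - t\<^sup>2 / 36)\<^sup>2"
    using c zero_le_power2[of "t * t"] by (simp add: power2_eq_square algebra_simps)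
  finally show ?thesis
    by (rule power2_le_imp_le) (use t in simp)
qed

subsection \<open>The local limit theorem\<close>

text \<open>The last two assumptions exclude both a degenerate covariance and a periodic lattice. A
  locale is used because it is interpreted again for weights tilted by an amount depending on
  \<open>n\<close>.\<close>

locale lattice_sample =
  fixes \<Omega> :: "'r set" and w :: "'r \<Rightarrow> real" and A :: "'r \<Rightarrow> 'a::finite set"
  assumes fin: "finite \<Omega>" and w_pos: "\<And>r. r \<in> \<Omega> \<Longrightarrow> 0 < w r" and w_sum: "sum w \<Omega> = 1"
    and ex_empty: "\<exists>r\<in>\<Omega>. A r = {}" and ex_singleton: "\<And>j. \<exists>r\<in>\<Omega>. A r = {j}"
begin

definition ind :: "'r \<Rightarrow> real^'a" where
  "ind r = (\<chi> j. of_bool (j \<in> A r))"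

definition \<mu> :: "real^'a" where
  "\<mu> = (\<Sum>r\<in>\<Omega>. w r *\<^sub>R ind r)"

definition cov :: "real^'a^'a" where
  "cov = (\<chi> i k. \<Sum>r\<in>\<Omega>. w r * ((ind r - \<mu>) $ i * (ind r - \<mu>) $ k))"

text \<open>Centring at \<open>\<mu>\<close> leaves the modulus of the characteristic function
  unchanged and removes the linear term of its expansion at 0.\<close>

definition charf :: "real^'a \<Rightarrow> complex" where
  "charf \<theta> = (\<Sum>r\<in>\<Omega>. of_real (w r) * cis (\<theta> \<bullet> (ind r - \<mu>)))"

lemma inner_ind: "\<theta> \<bullet> ind r = (\<Sum>j\<in>A r. \<theta> $ j)"
proof -
  have "\<theta> \<bullet> ind r = (\<Sum>j\<in>UNIV. if j \<in> A r then \<theta> $ j else 0)"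
    unfolding inner_vec_def ind_def by (intro sum.cong) auto
  then show ?thesis by (simp add: sum.If_cases)
qed

lemma sum_centred: "(\<Sum>r\<in>\<Omega>. w r * (\<theta> \<bullet> (ind r - \<mu>))) = 0"
proof -
  have "(\<Sum>r\<in>\<Omega>. w r * (\<theta> \<bullet> (ind r - \<mu>))) = \<theta> \<bullet> (\<Sum>r\<in>\<Omega>. w r *\<^sub>R ind r) - sum w \<Omega> * (\<theta> \<bullet> \<mu>)"
    by (simp add: inner_sum_right inner_diff_right algebra_simps sum_subtractf sum_distrib_right)
  then show ?thesis by (simp add: w_sum \<mu>_def[symmetric])
qed

lemma cov_quadratic: "\<theta> \<bullet> (cov *v \<theta>) = (\<Sum>r\<in>\<Omega>. w r * (\<theta> \<bullet> (ind r - \<mu>))\<^sup>2)"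
proof -
  have sq: "(\<theta> \<bullet> z)\<^sup>2 = (\<Sum>i\<in>UNIV. \<Sum>k\<in>UNIV. (\<theta> $ i * z $ i) * (\<theta> $ k * z $ k))" for z
    by (simp only: power2_eq_square inner_vec_def inner_real_def sum_product)
  have "\<theta> \<bullet> (cov *v \<theta>) = (\<Sum>i\<in>UNIV. \<Sum>k\<in>UNIV. \<Sum>r\<in>\<Omega>. w r * ((\<theta> $ i * (ind r - \<mu>) $ i) * (\<theta> $ k * (ind r - \<mu>) $ k)))"
    by (simp add: inner_vec_def matrix_vector_mult_def cov_def sum_distrib_left sum_distrib_right mult_ac)
  also have "\<dots> = (\<Sum>r\<in>\<Omega>. \<Sum>i\<in>UNIV. \<Sum>k\<in>UNIV. w r * ((\<theta> $ i * (ind r - \<mu>) $ i) * (\<theta> $ k * (ind r - \<mu>) $ k)))"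
    by (simp add: sum.swap[of _ _ \<Omega>])
  also have "\<dots> = (\<Sum>r\<in>\<Omega>. w r * (\<theta> \<bullet> (ind r - \<mu>))\<^sup>2)"
    unfolding sq sum_distrib_left ..
  finally show ?thesis .
qed

lemma cov_symmetric: "transpose cov = cov"
  by (simp add: transpose_def cov_def vec_eq_iff mult.commute)

text \<open>If the variance of \<open>\<theta> \<bullet> ind r\<close> vanishes, this quantity is
  constant on \<open>\<Omega>\<close>. An empty \<open>A r\<close> makes the constant 0, and the
  singletons then make every component of \<open>\<theta>\<close> vanish.\<close>

lemma cov_pos:
  assumes "\<theta> \<noteq> 0"
  shows "0 < \<theta> \<bullet> (cov *v \<theta>)"
proof (rule ccontr)
  assume "\<not> ?thesis"
  moreover have "0 \<le> \<theta> \<bullet> (cov *v \<theta>)"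
    unfolding cov_quadratic using w_pos by (intro sum_nonneg) (simp add: less_imp_le)
  ultimately have "(\<Sum>r\<in>\<Omega>. w r * (\<theta> \<bullet> (ind r - \<mu>))\<^sup>2) = 0"
    by (simp add: cov_quadratic)
  then have "\<forall>r\<in>\<Omega>. w r * (\<theta> \<bullet> (ind r - \<mu>))\<^sup>2 = 0"
    using w_pos fin by (subst (asm) sum_nonneg_eq_0_iff) (auto simp: less_imp_le)
  then have z: "\<theta> \<bullet> ind r = \<theta> \<bullet> \<mu>" if "r \<in> \<Omega>" for r
    using w_pos[OF that] that by (auto simp: inner_diff_right)
  have "\<theta> \<bullet> \<mu> = 0"
    using ex_empty z by (metis inner_ind sum.empty)
  then have "\<theta> $ j = 0" for j
    using ex_singleton[of j] z inner_ind[of \<theta>] by fastforce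
  then show False using assms by (simp add: vec_eq_iff)
qed

lemma det_cov_pos: "det cov > 0"
  using integral_gaussian_vec_cis(1)[OF cov_symmetric] cov_pos by blast

lemma charf_eq: "charf \<theta> = cis (- (\<theta> \<bullet> \<mu>)) * (\<Sum>r\<in>\<Omega>. of_real (w r) * cis (\<theta> \<bullet> ind r))"
  by (simp add: charf_def sum_distrib_left inner_diff_right cis_mult mult.left_commute)

lemma norm_charf_le_1: "norm (charf \<theta>) \<le> 1"
proof -
  have "norm (charf \<theta>) \<le> (\<Sum>r\<in>\<Omega>. norm (of_real (w r) * cis (\<theta> \<bullet> (ind r - \<mu>))))"
    unfolding charf_def by (rule norm_sum)
  also have "\<dots> = sum w \<Omega>"
    using w_pos by (intro sum.cong) (auto simp: norm_mult less_imp_le)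
  finally show ?thesis by (simp add: w_sum)
qed

text \<open>Mass \<open>\<epsilon>\<close> is taken from a point with empty set and from one with
  set \<open>{j}\<close>; together they contribute
  \<open>\<epsilon> * (1 + cis (\<theta> $ j))\<close>, where cancellation is quantified by
  \<open>norm_one_plus_cis_le\<close>. The remaining mass \<open>1 - 2 * \<epsilon>\<close> is
  bounded trivially.\<close>

lemma norm_charf_le:
  assumes eps: "0 < \<epsilon>" "\<And>r. r \<in> \<Omega> \<Longrightarrow> \<epsilon> \<le> w r" and \<theta>: "\<And>j. \<bar>\<theta> $ j\<bar> \<le> pi"
  shows "norm (charf \<theta>) \<le> exp (- (\<epsilon> / (36 * CARD('a)) * (\<theta> \<bullet> \<theta>)))"
proof -
  have comp: "norm (charf \<theta>) \<le> 1 - \<epsilon> / 36 * (\<theta> $ j)\<^sup>2" for j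
  proof -
    obtain r0 r1 where r: "r0 \<in> \<Omega>" "A r0 = {}" "r1 \<in> \<Omega>" "A r1 = {j}"
      using ex_empty ex_singleton by blast
    then have ne: "r0 \<noteq> r1" by auto
    let ?R = "\<Omega> - {r0, r1}"
    have split: "sum f \<Omega> = f r0 + f r1 + sum f ?R" for f :: "'r \<Rightarrow> 'b::comm_monoid_add"
    proof -
      have "sum f \<Omega> = sum f {r0, r1} + sum f ?R"
        using r fin by (metis add.commute bot_least insert_subset sum.subset_diff)
      then show ?thesis using ne by simp
    qed
    let ?z = "cis (\<theta> $ j)"
    have "norm (charf \<theta>) = norm (\<Sum>r\<in>\<Omega>. of_real (w r) * cis (\<theta> \<bullet> ind r))"
      by (simp add: charf_eq norm_mult)
    also have "\<dots> = norm ((of_real (w r0 - \<epsilon>) + of_real (w r1 - \<epsilon>) * ?z + of_real \<epsilon> * (1 + ?z)) + (\<Sum>r\<in>?R. of_real (w r) * cis (\<theta> \<bullet> ind r)))"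
      unfolding split[of "\<lambda>r. complex_of_real (w r) * cis (\<theta> \<bullet> ind r)"]
      using r by (simp add: inner_ind algebra_simps)
    also have "\<dots> \<le> norm (complex_of_real (w r0 - \<epsilon>)) + norm (of_real (w r1 - \<epsilon>) * ?z) + norm (of_real \<epsilon> * (1 + ?z))
        + (\<Sum>r\<in>?R. norm (of_real (w r) * cis (\<theta> \<bullet> ind r)))"
      by (intro norm_triangle_mono norm_sum order_refl)
    also have "\<dots> = (w r0 - \<epsilon>) + (w r1 - \<epsilon>) + \<epsilon> * norm (1 + ?z) + (\<Sum>r\<in>?R. w r)"
    proof -
      have "(\<Sum>r\<in>?R. norm (of_real (w r) * cis (\<theta> \<bullet> ind r))) = (\<Sum>r\<in>?R. w r)"
        using w_pos by (intro sum.cong) (auto simp: norm_mult less_imp_le)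
      then show ?thesis
        using eps r by (simp add: norm_mult flip: of_real_diff)
    qed
    also have "\<dots> \<le> (w r0 - \<epsilon>) + (w r1 - \<epsilon>) + \<epsilon> * (2 - (\<theta> $ j)\<^sup>2 / 36) + (\<Sum>r\<in>?R. w r)"
      using eps \<theta> by (intro add_mono mult_left_mono norm_one_plus_cis_le) auto
    also have "\<dots> = 1 - \<epsilon> / 36 * (\<theta> $ j)\<^sup>2"
      using split[of w] w_sum by (simp add: algebra_simps)
    finally show ?thesis .
  qed
  \<comment> \<open>Averaging the bounds over the coordinates turns the single squares into
    \<open>\<theta> \<bullet> \<theta>\<close>, at the price of the factor \<open>CARD('a)\<close>
    in the constant.\<close>
  have "CARD('a) * norm (charf \<theta>) = (\<Sum>j\<in>(UNIV::'a set). norm (charf \<theta>))"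
    by simp
  also have "\<dots> \<le> (\<Sum>j\<in>UNIV. 1 - \<epsilon> / 36 * (\<theta> $ j)\<^sup>2)"
    by (intro sum_mono comp)
  also have "\<dots> = CARD('a) - \<epsilon> / 36 * (\<theta> \<bullet> \<theta>)"
    by (simp add: sum_subtractf inner_vec_def power2_eq_square sum_distrib_left)
  finally have "norm (charf \<theta>) \<le> 1 + - (\<epsilon> / (36 * CARD('a)) * (\<theta> \<bullet> \<theta>))"
    by (simp add: field_simps)
  also have "\<dots> \<le> exp (- (\<epsilon> / (36 * CARD('a)) * (\<theta> \<bullet> \<theta>)))"
    by (rule exp_ge_add_one_self)
  finally show ?thesis .
qed

lemma continuous_charf: "continuous_on UNIV charf"
  unfolding charf_def by (intro continuous_intros)

lemma measurable_charf [measurable]: "charf \<in> borel_measurable borel"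
  using continuous_charf by (rule borel_measurable_continuous_onI)

abbreviation q :: "nat \<Rightarrow> ('a \<Rightarrow> int) \<Rightarrow> real" where
  "q \<equiv> count_weight \<Omega> w A"

lemma measurable_cis_inner [measurable]: "(\<lambda>\<theta>. cis (- (\<theta> \<bullet> x))) \<in> borel_measurable borel" for x :: "real^'a"
  by (intro borel_measurable_continuous_onI continuous_intros)

lemma q_nonneg: "0 \<le> q n k"
  by (rule count_weight_nonneg) (simp add: less_imp_le w_pos)

text \<open>The substitution \<open>\<theta> = \<eta> / sqrt n\<close> has the Jacobian that is
  moved to the left. Centring shifts \<open>n \<mu>\<close> into the exponential, so the frequency
  is the standardised deviation of \<open>k\<close>.\<close>

lemma q_scaled_Fourier:
  assumes "n > 0"
  defines "B \<equiv> cbox (\<chi> i. - pi * sqrt (real n)) (\<chi> i. pi * sqrt (real n)) :: (real^'a) set"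
  shows "complex_of_real ((2 * pi) ^ CARD('a) * (sqrt (real n) ^ CARD('a) * q n k))
    = (\<integral>\<eta>. indicator B \<eta> *\<^sub>R (charf ((1 / sqrt (real n)) *\<^sub>R \<eta>) ^ n
         * cis (- (\<eta> \<bullet> (\<chi> j. (of_int (k j) - real n * \<mu> $ j) / sqrt (real n))))) \<partial>lborel)"
proof -
  define s where "s = 1 / sqrt (real n)"
  have s: "s > 0" using assms by (simp add: s_def)
  let ?C = "cbox (\<chi> i. - pi) (\<chi> i. pi) :: (real^'a) set"
  let ?x = "(\<chi> j. of_int (k j) - real n * \<mu> $ j) :: real^'a"
  have pw: "(\<Sum>r\<in>\<Omega>. of_real (w r) * cis (\<Sum>j\<in>A r. \<theta> $ j)) ^ n * cis (- (\<Sum>j\<in>UNIV. \<theta> $ j * of_int (k j)))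
      = charf \<theta> ^ n * cis (- (\<theta> \<bullet> ?x))" for \<theta>
  proof -
    have "(\<Sum>r\<in>\<Omega>. of_real (w r) * cis (\<theta> \<bullet> ind r)) = cis (\<theta> \<bullet> \<mu>) * charf \<theta>"
      by (simp add: charf_eq mult.assoc[symmetric] cis_mult)
    moreover have "(\<Sum>j\<in>UNIV. \<theta> $ j * of_int (k j)) = \<theta> \<bullet> ?x + real n * (\<theta> \<bullet> \<mu>)"
      by (simp add: inner_vec_def algebra_simps sum_subtractf sum_distrib_left)
    ultimately show ?thesis
      by (simp add: inner_ind power_mult_distrib Complex.DeMoivre cis_mult mult.assoc[symmetric])
  qed
  have B: "indicator ?C (s *\<^sub>R \<eta>) = (indicator B \<eta> :: real)" for \<eta>
    using assms(1) by (auto simp: indicator_def B_def mem_box_cart s_def field_simps)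
  have sc: "(s *\<^sub>R \<eta>) \<bullet> ?x = \<eta> \<bullet> (\<chi> j. (of_int (k j) - real n * \<mu> $ j) / sqrt (real n))" for \<eta>
    by (simp add: inner_vec_def s_def sum_distrib_left)
  have "complex_of_real ((2 * pi) ^ CARD('a) * q n k)
      = s ^ CARD('a) *\<^sub>R (\<integral>\<eta>. indicator ?C (s *\<^sub>R \<eta>) *\<^sub>R (charf (s *\<^sub>R \<eta>) ^ n * cis (- ((s *\<^sub>R \<eta>) \<bullet> ?x))) \<partial>lborel)"
    unfolding count_weight_Fourier[OF fin] pw using s
    by (rule integral_lborel_scale_vec) measurable
  then have "complex_of_real ((2 * pi) ^ CARD('a) * q n k)
      = s ^ CARD('a) *\<^sub>R (\<integral>\<eta>. indicator B \<eta> *\<^sub>R (charf (s *\<^sub>R \<eta>) ^ n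
         * cis (- (\<eta> \<bullet> (\<chi> j. (of_int (k j) - real n * \<mu> $ j) / sqrt (real n))))) \<partial>lborel)" (is "_ = _ *\<^sub>R ?I")
    unfolding B sc .
  then have "complex_of_real ((2 * pi) ^ CARD('a) * (sqrt (real n) ^ CARD('a) * q n k))
      = complex_of_real (sqrt (real n) ^ CARD('a) * s ^ CARD('a)) * ?I"
    by (simp add: scaleR_conv_of_real mult_ac)
  also have "sqrt (real n) ^ CARD('a) * s ^ CARD('a) = 1"
    using assms(1) by (simp add: s_def power_one_over)
  finally show ?thesis by (simp add: s_def)
qed

text \<open>The power \<open>n\<close> cancels the \<open>1 / n\<close> coming from the squared
  scale, so the bound is free of \<open>n\<close> and can serve as a dominating function.\<close>

lemma norm_scaled_integrand_le:
  assumes eps: "0 < \<epsilon>" "\<And>r. r \<in> \<Omega> \<Longrightarrow> \<epsilon> \<le> w r" and "n > 0"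
  shows "norm (indicator (cbox (\<chi> i. - pi * sqrt (real n)) (\<chi> i. pi * sqrt (real n))) \<eta> *\<^sub>R
      (charf ((1 / sqrt (real n)) *\<^sub>R \<eta>) ^ n * cis y)) \<le> exp (- (\<epsilon> / (36 * CARD('a))) * (\<eta> \<bullet> \<eta>))"
proof (cases "\<eta> \<in> cbox (\<chi> i. - pi * sqrt (real n)) (\<chi> i. pi * sqrt (real n))")
  case True
  then have "\<bar>\<eta> $ j\<bar> \<le> pi * sqrt (real n)" for j
    by (auto simp: mem_box_cart abs_le_iff) (metis minus_le_iff)
  then have "\<bar>((1 / sqrt (real n)) *\<^sub>R \<eta>) $ j\<bar> \<le> pi" for j
    using \<open>n > 0\<close> by (simp add: abs_mult field_simps)
  from norm_charf_le[OF eps this]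
  have "norm (charf ((1 / sqrt (real n)) *\<^sub>R \<eta>)) ^ n
      \<le> exp (- (\<epsilon> / (36 * CARD('a)) * (((1 / sqrt (real n)) *\<^sub>R \<eta>) \<bullet> ((1 / sqrt (real n)) *\<^sub>R \<eta>)))) ^ n"
    by (intro power_mono) auto
  also have "\<dots> = exp (- (\<epsilon> / (36 * CARD('a))) * (\<eta> \<bullet> \<eta>))"
    using \<open>n > 0\<close> by (simp add: exp_of_nat_mult[symmetric] field_simps)
  finally show ?thesis using True by (simp add: norm_mult norm_power)
qed simp

text \<open>The right-hand side depends on \<open>w\<close> only through \<open>\<epsilon>\<close>,
  so the estimate applies uniformly to tilts that change with \<open>n\<close>.\<close>

lemma q_upper_bound:
  assumes eps: "0 < \<epsilon>" "\<And>r. r \<in> \<Omega> \<Longrightarrow> \<epsilon> \<le> w r" and "n > 0"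
  shows "sqrt (real n) ^ CARD('a) * q n k
    \<le> (\<integral>\<eta>. exp (- (\<epsilon> / (36 * CARD('a))) * (\<eta> \<bullet> (\<eta>::real^'a))) \<partial>lborel) / (2 * pi) ^ CARD('a)"
proof -
  have "\<epsilon> / (36 * CARD('a)) > 0" using eps by simp
  note int = integrable_exp_neg_inner[OF this, where 'a='a]
  have "(2 * pi) ^ CARD('a) * (sqrt (real n) ^ CARD('a) * q n k)
      = norm (complex_of_real ((2 * pi) ^ CARD('a) * (sqrt (real n) ^ CARD('a) * q n k)))"
    using q_nonneg by (simp only: norm_of_real) simp
  also have "\<dots> \<le> (\<integral>\<eta>. exp (- (\<epsilon> / (36 * CARD('a))) * (\<eta> \<bullet> (\<eta>::real^'a))) \<partial>lborel)"
    unfolding q_scaled_Fourier[OF \<open>n > 0\<close>]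
    by (rule order_trans[OF integral_norm_bound integral_mono'[OF int]])
       (rule norm_scaled_integrand_le[OF eps \<open>n > 0\<close>], simp_all)
  finally show ?thesis by (simp add: field_simps)
qed

text \<open>The second-order expansion has error of order \<open>n powr (-3/2)\<close>. Since
  \<open>\<bar>a ^ n - b ^ n\<bar> \<le> n * \<bar>a - b\<bar>\<close> in the unit disc, the powers
  differ by \<open>O(1 / sqrt n)\<close>, and the comparison sequence is the classical one for the
  exponential.\<close>

lemma charf_power_tendsto:
  "(\<lambda>n. charf ((1 / sqrt (real n)) *\<^sub>R \<eta>) ^ n) \<longlonglongrightarrow> of_real (exp (- (\<eta> \<bullet> (cov *v \<eta>)) / 2))"
proof -
  define y where "y = (\<lambda>r. \<eta> \<bullet> (ind r - \<mu>))"
  define \<sigma> where "\<sigma> = \<eta> \<bullet> (cov *v \<eta>)"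
  define K where "K = (\<Sum>r\<in>\<Omega>. w r * \<bar>y r\<bar> ^ 3 / 6)"
  have \<sigma>: "\<sigma> = (\<Sum>r\<in>\<Omega>. w r * (y r)\<^sup>2)" by (simp add: \<sigma>_def cov_quadratic y_def)
  have \<sigma>0: "\<sigma> \<ge> 0" unfolding \<sigma> using w_pos by (intro sum_nonneg) (simp add: less_imp_le)
  have taylor: "norm (charf ((1 / sqrt (real n)) *\<^sub>R \<eta>) - of_real (1 + (- \<sigma> / 2) / real n)) \<le> K * (1 / sqrt (real n)) ^ 3"
    if "n > 0" for n
  proof -
    define s where "s = 1 / sqrt (real n)"
    have s: "s > 0" "s\<^sup>2 = 1 / real n" using that by (auto simp: s_def power_divide)
    have "(\<Sum>r\<in>\<Omega>. w r * y r) = 0" unfolding y_def by (rule sum_centred)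
    then have "complex_of_real (1 + (- \<sigma> / 2) / real n)
        = of_real (sum w \<Omega> + 0 - (\<Sum>r\<in>\<Omega>. w r * (y r)\<^sup>2) * s\<^sup>2 / 2) + \<i> * of_real (s * (\<Sum>r\<in>\<Omega>. w r * y r))"
      by (simp add: w_sum \<sigma>[symmetric] s)
    also have "\<dots> = (\<Sum>r\<in>\<Omega>. of_real (w r) * (1 + \<i> * of_real (s * y r) - of_real ((s * y r)\<^sup>2 / 2)))"
      by (simp add: sum.distrib sum_subtractf sum_distrib_left sum_distrib_right sum_divide_distrib algebra_simps power_mult_distrib)
    finally have 1: "complex_of_real (1 + (- \<sigma> / 2) / real n)
        = (\<Sum>r\<in>\<Omega>. of_real (w r) * (1 + \<i> * of_real (s * y r) - of_real ((s * y r)\<^sup>2 / 2)))" .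
    have 2: "charf (s *\<^sub>R \<eta>) = (\<Sum>r\<in>\<Omega>. of_real (w r) * cis (s * y r))"
      by (simp add: charf_def y_def)
    have eq: "charf (s *\<^sub>R \<eta>) - of_real (1 + (- \<sigma> / 2) / real n)
        = (\<Sum>r\<in>\<Omega>. of_real (w r) * (cis (s * y r) - (1 + \<i> * of_real (s * y r) - of_real ((s * y r)\<^sup>2 / 2))))"
      unfolding 1 2 by (simp only: sum_subtractf right_diff_distrib)
    have approx: "norm (cis u - (1 + \<i> * of_real u - of_real (u\<^sup>2 / 2))) \<le> \<bar>u\<bar> ^ 3 / 6" for u :: real
      using iexp_approx1[of u 2] by (simp add: cis_conv_exp eval_nat_numeral atMost_Suc algebra_simps)
    have "norm (charf (s *\<^sub>R \<eta>) - of_real (1 + (- \<sigma> / 2) / real n)) \<le> (\<Sum>r\<in>\<Omega>. w r * (\<bar>s * y r\<bar> ^ 3 / 6))"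
      unfolding eq
    proof (rule sum_norm_le)
      fix r assume "r \<in> \<Omega>"
      then show "norm (of_real (w r) * (cis (s * y r) - (1 + \<i> * of_real (s * y r) - of_real ((s * y r)\<^sup>2 / 2)))) \<le> w r * (\<bar>s * y r\<bar> ^ 3 / 6)"
        unfolding norm_mult using w_pos[of r] approx[of "s * y r"] by (intro mult_mono) auto
    qed
    also have "\<dots> = K * s ^ 3"
      using s by (simp add: K_def sum_distrib_left abs_mult power_mult_distrib mult_ac)
    finally show ?thesis by (simp add: s_def)
  qed
  have lim1: "(\<lambda>n. complex_of_real ((1 + (- \<sigma> / 2) / real n) ^ n)) \<longlonglongrightarrow> of_real (exp (- \<sigma> / 2))"
    by (intro tendsto_of_real tendsto_exp_limit_sequentially)
  have "(\<lambda>n. charf ((1 / sqrt (real n)) *\<^sub>R \<eta>) ^ n - complex_of_real ((1 + (- \<sigma> / 2) / real n) ^ n)) \<longlonglongrightarrow> 0"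
  proof (rule Lim_null_comparison)
    show "(\<lambda>n. K * (1 / sqrt (real n))) \<longlonglongrightarrow> 0"
      by real_asymp
    show "\<forall>\<^sub>F n in sequentially. norm (charf ((1 / sqrt (real n)) *\<^sub>R \<eta>) ^ n - complex_of_real ((1 + (- \<sigma> / 2) / real n) ^ n)) \<le> K * (1 / sqrt (real n))"
      using eventually_gt_at_top[of "nat \<lceil>\<sigma>\<rceil>"]
    proof eventually_elim
      case (elim n)
      then have n: "n > 0" "\<sigma> \<le> real n" by linarith+
      \<comment> \<open>Both bases must lie in the unit disc;
        \<open>0 \<le> \<sigma> \<le> n\<close> ensures this for
        \<open>1 - \<sigma> / (2 * n)\<close>.\<close>
      have b: "norm (complex_of_real (1 + (- \<sigma> / 2) / real n)) \<le> 1"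
        unfolding norm_of_real using n \<sigma>0 by (simp add: abs_le_iff field_simps)
      have "norm (charf ((1 / sqrt (real n)) *\<^sub>R \<eta>) ^ n - complex_of_real (1 + (- \<sigma> / 2) / real n) ^ n)
          \<le> real n * norm (charf ((1 / sqrt (real n)) *\<^sub>R \<eta>) - complex_of_real (1 + (- \<sigma> / 2) / real n))"
        by (rule norm_power_diff[OF norm_charf_le_1 b])
      also have "\<dots> \<le> real n * (K * (1 / sqrt (real n)) ^ 3)"
        by (intro mult_left_mono taylor n) auto
      also have "\<dots> = K * (1 / sqrt (real n))"
        using n by (simp add: power3_eq_cube field_simps)
      finally show ?case by simp
    qed
  qed
  from tendsto_add[OF this lim1] show ?thesis by (simp add: \<sigma>_def)
qed

text \<open>Dominated convergence in the scaled inversion formula: the cubes exhaust the space, the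
  powers tend to a Gaussian and the frequencies to \<open>x\<close>. The inverse covariance enters
  through the Fourier transform of that Gaussian.\<close>

lemma local_limit:
  assumes x: "\<And>j. (\<lambda>n. (of_int (k n j) - real n * \<mu> $ j) / sqrt (real n)) \<longlonglongrightarrow> x $ j"
  shows "(\<lambda>n. sqrt (real n) ^ CARD('a) * q n (k n))
    \<longlonglongrightarrow> exp (- (x \<bullet> (matrix_inv cov *v x)) / 2) / sqrt ((2 * pi) ^ CARD('a) * det cov)"
proof -
  define \<epsilon> where "\<epsilon> = Min (w ` \<Omega>)"
  have ne: "\<Omega> \<noteq> {}" using ex_empty by auto
  have eps: "0 < \<epsilon>" "\<And>r. r \<in> \<Omega> \<Longrightarrow> \<epsilon> \<le> w r"
    using fin ne w_pos by (auto simp: \<epsilon>_def)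
  have c: "\<epsilon> / (36 * CARD('a)) > 0" using eps by simp
  define y where "y = (\<lambda>n. (\<chi> j. (of_int (k n j) - real n * \<mu> $ j) / sqrt (real n)) :: real^'a)"
  define B where "B = (\<lambda>n. cbox (\<chi> i. - pi * sqrt (real n)) (\<chi> i. pi * sqrt (real n)) :: (real^'a) set)"
  define F where "F = (\<lambda>n \<eta>. indicator (B n) \<eta> *\<^sub>R (charf ((1 / sqrt (real n)) *\<^sub>R \<eta>) ^ n * cis (- (\<eta> \<bullet> y n))))"
  define G where "G = (\<lambda>\<eta>. complex_of_real (exp (- (\<eta> \<bullet> (cov *v \<eta>)) / 2)) * cis (- (\<eta> \<bullet> x)))"
  have y: "y \<longlonglongrightarrow> x"
    by (rule vec_tendstoI) (simp add: y_def x)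
  have ptw: "(\<lambda>n. F n \<eta>) \<longlonglongrightarrow> G \<eta>" for \<eta>
  proof -
    have "\<forall>\<^sub>F n in sequentially. norm \<eta> \<le> pi * sqrt (real n)"
      by real_asymp
    then have "\<forall>\<^sub>F n in sequentially. indicator (B n) \<eta> = (1::real)"
    proof eventually_elim
      case (elim n)
      have "- (pi * sqrt (real n)) \<le> \<eta> $ j \<and> \<eta> $ j \<le> pi * sqrt (real n)" for j
        using component_le_norm_cart[of \<eta> j] elim by linarith
      then show ?case by (simp add: B_def mem_box_cart)
    qed
    then have "(\<lambda>n. indicator (B n) \<eta> :: real) \<longlonglongrightarrow> 1"
      by (rule tendsto_eventually)
    moreover have "(\<lambda>n. cis (- (\<eta> \<bullet> y n))) \<longlonglongrightarrow> cis (- (\<eta> \<bullet> x))"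
      by (intro tendsto_intros y)
    ultimately have "(\<lambda>n. F n \<eta>) \<longlonglongrightarrow> 1 *\<^sub>R G \<eta>"
      unfolding F_def G_def by (intro tendsto_intros charf_power_tendsto y)
    then show ?thesis by simp
  qed
  have G_eq: "integrable lborel G" "(\<integral>\<eta>. G \<eta> \<partial>lborel)
      = of_real (sqrt ((2 * pi) ^ CARD('a)) / sqrt (det cov) * exp (- (x \<bullet> (matrix_inv cov *v x)) / 2))"
    unfolding G_def by (rule integral_gaussian_vec_cis; simp add: cov_symmetric cov_pos)+
  have "(\<lambda>n. \<integral>\<eta>. F (Suc n) \<eta> \<partial>lborel) \<longlonglongrightarrow> (\<integral>\<eta>. G \<eta> \<partial>lborel)"
  proof (rule integral_dominated_convergence[where w="\<lambda>\<eta>. exp (- (\<epsilon> / (36 * CARD('a))) * (\<eta> \<bullet> \<eta>))"])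
    show "G \<in> borel_measurable lborel" using G_eq(1) by auto
    show "F (Suc n) \<in> borel_measurable lborel" for n
      unfolding F_def B_def by measurable
    show "integrable lborel (\<lambda>\<eta>::real^'a. exp (- (\<epsilon> / (36 * CARD('a))) * (\<eta> \<bullet> \<eta>)))"
      by (rule integrable_exp_neg_inner[OF c])
    show "AE \<eta> in lborel. (\<lambda>n. F (Suc n) \<eta>) \<longlonglongrightarrow> G \<eta>"
      by (intro AE_I2 LIMSEQ_Suc ptw)
    show "AE \<eta> in lborel. norm (F (Suc n) \<eta>) \<le> exp (- (\<epsilon> / (36 * CARD('a))) * (\<eta> \<bullet> \<eta>))" for n
      unfolding F_def B_def by (intro AE_I2 norm_scaled_integrand_le[OF eps]) auto
  qed
  then have "(\<lambda>n. \<integral>\<eta>. F n \<eta> \<partial>lborel) \<longlonglongrightarrow> (\<integral>\<eta>. G \<eta> \<partial>lborel)"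
    by (rule LIMSEQ_imp_Suc)
  moreover have "\<forall>\<^sub>F n in sequentially. (\<integral>\<eta>. F n \<eta> \<partial>lborel)
      = complex_of_real ((2 * pi) ^ CARD('a) * (sqrt (real n) ^ CARD('a) * q n (k n)))"
    using eventually_gt_at_top[of 0]
    by eventually_elim (simp only: q_scaled_Fourier F_def B_def y_def)
  ultimately have "(\<lambda>n. complex_of_real ((2 * pi) ^ CARD('a) * (sqrt (real n) ^ CARD('a) * q n (k n))))
      \<longlonglongrightarrow> of_real (sqrt ((2 * pi) ^ CARD('a)) / sqrt (det cov) * exp (- (x \<bullet> (matrix_inv cov *v x)) / 2))"
    unfolding G_eq(2) by (rule Lim_transform_eventually)
  then have "(\<lambda>n. (2 * pi) ^ CARD('a) * (sqrt (real n) ^ CARD('a) * q n (k n)))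
      \<longlonglongrightarrow> sqrt ((2 * pi) ^ CARD('a)) / sqrt (det cov) * exp (- (x \<bullet> (matrix_inv cov *v x)) / 2)"
    by (simp only: tendsto_of_real_iff)
  then have "(\<lambda>n. (2 * pi) ^ CARD('a) * (sqrt (real n) ^ CARD('a) * q n (k n)) / (2 * pi) ^ CARD('a))
      \<longlonglongrightarrow> sqrt ((2 * pi) ^ CARD('a)) / sqrt (det cov) * exp (- (x \<bullet> (matrix_inv cov *v x)) / 2) / (2 * pi) ^ CARD('a)"
    by (intro tendsto_divide tendsto_const) auto
  moreover have "sqrt ((2 * pi) ^ CARD('a)) / sqrt (det cov) * exp (- (x \<bullet> (matrix_inv cov *v x)) / 2) / (2 * pi) ^ CARD('a)
      = exp (- (x \<bullet> (matrix_inv cov *v x)) / 2) / sqrt ((2 * pi) ^ CARD('a) * det cov)"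
  proof -
    define D where "D = (2 * pi) ^ CARD('a)"
    have "D > 0" by (simp add: D_def)
    then have "sqrt D / D = 1 / sqrt D"
      by (metis real_div_sqrt divide_divide_eq_right inverse_eq_divide less_imp_le mult.commute divide_inverse real_sqrt_divide sqrt_divide_self_eq)
    then have "sqrt D / sqrt (det cov) * e / D = e / sqrt (D * det cov)" for e
      by (simp add: real_sqrt_mult) (metis (no_types, lifting) divide_divide_eq_left' mult.commute times_divide_eq_left times_divide_eq_right mult_1)
    then show ?thesis by (simp add: D_def)
  qed
  ultimately show ?thesis by simp
qed

end

subsection \<open>Sums over an orthant\<close>

text \<open>A multiple of the exponential density. The shift in \<open>1 - y\<close> allows for
  rounding: \<open>\<lceil>y\<rceil> - 1 \<ge> y - 1\<close>.\<close>

lemma integrable_exp_neg_half_line: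
  assumes "0 < (\<kappa>::real)"
  shows "integrable lborel (\<lambda>y. indicator {0<..} y * exp (\<kappa> * (1 - y)))"
proof -
  interpret prob_space "density lborel (exponential_density \<kappa>)"
    using assms by (rule prob_space_exponential_density)
  have "integrable (density lborel (exponential_density \<kappa>)) (\<lambda>_. 1::real)"
    by simp
  then have "integrable lborel (exponential_density \<kappa>)"
    using assms by (subst (asm) integrable_density) (auto simp: exponential_density_def[abs_def])
  then have "integrable lborel (\<lambda>y. exp \<kappa> / \<kappa> * exponential_density \<kappa> y)"
    by (rule integrable_mult_right)
  then show ?thesis
    by (rule Bochner_Integration.integrable_bound)
       (use assms in \<open>auto simp: exponential_density_def indicator_def exp_diff exp_minus field_simps\<close>)
qed

text \<open>The integrand equals \<open>z ^ l\<close> on the cell from \<open>l\<close> (excluded)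
  to \<open>l + 1\<close> (included), so its integral is the geometric series.\<close>

lemma integral_geometric_step:
  assumes "0 < (z::real)" "z < 1"
  shows "(\<integral>y. indicator {0<..} y * z ^ nat (\<lceil>y\<rceil> - 1) \<partial>(lborel :: real measure)) = 1 / (1 - z)"
proof -
  have "(\<integral>\<^sup>+y. ennreal (indicator {0<..} y * z ^ nat (\<lceil>y\<rceil> - 1)) \<partial>(lborel :: real measure))
      = (\<integral>\<^sup>+y. (\<Sum>l. ennreal (z ^ l) * indicator {real l<..real l + 1} y) \<partial>lborel)"
  proof (intro nn_integral_cong)
    fix y :: real
    show "ennreal (indicator {0<..} y * z ^ nat (\<lceil>y\<rceil> - 1)) = (\<Sum>l. ennreal (z ^ l) * indicator {real l<..real l + 1} y)"
    proof (cases "0 < y")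
      case True
      have "y \<in> {real l<..real l + 1} \<longleftrightarrow> l = nat (\<lceil>y\<rceil> - 1)" for l
        using True by (simp, linarith)
      then have "(\<Sum>l. ennreal (z ^ l) * indicator {real l<..real l + 1} y)
          = (\<Sum>l. if l = nat (\<lceil>y\<rceil> - 1) then ennreal (z ^ nat (\<lceil>y\<rceil> - 1)) else 0)"
        by (intro suminf_cong) (auto simp: indicator_def)
      also have "\<dots> = ennreal (z ^ nat (\<lceil>y\<rceil> - 1))"
        using sums_single[of "nat (\<lceil>y\<rceil> - 1)" "\<lambda>_. ennreal (z ^ nat (\<lceil>y\<rceil> - 1))"] by (simp add: sums_iff)
      finally show ?thesis using True by simp
    next
      case False
      then have "ennreal (z ^ l) * indicator {real l<..real l + 1} y = 0" for l
        by (auto simp: indicator_def)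
      then show ?thesis using False by simp
    qed
  qed
  also have "\<dots> = (\<Sum>l. ennreal (z ^ l))"
    by (subst nn_integral_suminf) (auto simp: nn_integral_cmult)
  also have "\<dots> = ennreal (1 / (1 - z))"
    using geometric_sums[of z] assms by (intro suminf_ennreal_eq) auto
  finally show ?thesis
    using assms by (subst integral_eq_nn_integral) auto
qed

section \<open>Uniform decay of the count law and the limit of the orthant sum\<close>

context lattice_sample
begin

text \<open>Tilting by \<open>exp (- |A r \<inter> C| / sqrt n)\<close> keeps the local bound uniform and turns it into
  exponential decay on the scale \<open>sqrt n\<close>; the normalising constant to the power \<open>n\<close> stays bounded
  because the exponent is linear in \<open>1 / sqrt n\<close> up to a second order error.\<close>

lemma q_tilted_bound:
  fixes C :: "'a set"
  obtains K where "\<And>n k. n > 0 \<Longrightarrow> sqrt (real n) ^ CARD('a) * q n k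
    \<le> K * exp (\<Sum>j\<in>C. (of_int (k j) - real n * \<mu> $ j) / sqrt (real n))"
proof -
  define \<epsilon> where "\<epsilon> = Min (w ` \<Omega>)"
  have ne: "\<Omega> \<noteq> {}" using ex_empty by auto
  have eps: "0 < \<epsilon>" "\<And>r. r \<in> \<Omega> \<Longrightarrow> \<epsilon> \<le> w r"
    using fin ne w_pos by (auto simp: \<epsilon>_def)
  \<comment> \<open>A lower bound for the tilted weights that does not depend on \<open>n\<close>:
    the tilting exponent is at least \<open>- CARD('a)\<close> because \<open>s \<le> 1\<close>, and
    division by \<open>Z \<le> 1\<close> does not decrease the weights.\<close>
  define \<epsilon>' where "\<epsilon>' = \<epsilon> * exp (- real CARD('a))"
  have eps': "\<epsilon>' > 0" using eps by (simp add: \<epsilon>'_def)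
  define K0 where "K0 = (\<integral>\<eta>. exp (- (\<epsilon>' / (36 * CARD('a))) * (\<eta> \<bullet> (\<eta>::real^'a))) \<partial>lborel) / (2 * pi) ^ CARD('a)"
  have K0: "K0 \<ge> 0" by (simp add: K0_def)
  define e :: "real^'a" where "e = (\<chi> j. of_bool (j \<in> C))"
  define y where "y = (\<lambda>r. e \<bullet> (ind r - \<mu>))"
  define D where "D = (\<Sum>r\<in>\<Omega>. \<bar>y r\<bar>)"
  \<comment> \<open>Bounds the second-order Taylor remainder of \<open>exp (- s * y r)\<close>
    divided by \<open>s\<^sup>2\<close>, as \<open>\<bar>s * y r\<bar> \<le> D\<close>.\<close>
  define E where "E = exp D * D\<^sup>2"
  have y: "\<bar>y r\<bar> \<le> D" if "r \<in> \<Omega>" for r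
    unfolding D_def using fin that by (intro member_le_sum) auto
  have D0: "D \<ge> 0" by (simp add: D_def sum_nonneg)
  have e\<mu>: "e \<bullet> v = (\<Sum>j\<in>C. v $ j)" for v
    by (simp add: inner_vec_def e_def sum.If_cases if_distrib of_bool_def if_distribR Int_def cong: if_cong)
  show thesis
  proof (rule that[of "K0 * exp E"])
    fix n :: nat and k :: "'a \<Rightarrow> int" assume n: "n > 0"
    define s where "s = 1 / sqrt (real n)"
    have s: "0 < s" "s \<le> 1" "s\<^sup>2 = 1 / real n"
      using n by (auto simp: s_def power_divide)
    define t where "t = (\<lambda>j. - s * e $ j)"
    define Z where "Z = (\<Sum>r\<in>\<Omega>. w r * exp (\<Sum>j\<in>A r. t j))"
    define w' where "w' = (\<lambda>r. w r * exp (\<Sum>j\<in>A r. t j) / Z)"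
    have t_sum: "(\<Sum>j\<in>A r. t j) = - s * (e \<bullet> ind r)" for r
      by (simp add: t_def inner_ind sum_distrib_left)
    have Z_pos: "Z > 0"
      unfolding Z_def using fin ne w_pos by (intro sum_pos) auto
    have e_ind: "0 \<le> e \<bullet> ind r" "e \<bullet> ind r \<le> CARD('a)" for r
    proof -
      show "0 \<le> e \<bullet> ind r" by (simp add: inner_ind e_def sum_nonneg)
      have "e \<bullet> ind r \<le> (\<Sum>j\<in>A r. 1)" unfolding inner_ind by (intro sum_mono) (simp add: e_def)
      also have "\<dots> \<le> CARD('a)" by (simp add: card_mono)
      finally show "e \<bullet> ind r \<le> CARD('a)" .
    qed
    have Z_le: "Z \<le> 1"
    proof -
      have "Z \<le> (\<Sum>r\<in>\<Omega>. w r)"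
        unfolding Z_def t_sum using w_pos s e_ind by (intro sum_mono) (simp add: less_imp_le mult_left_le)
      then show ?thesis by (simp add: w_sum)
    qed
    interpret T: lattice_sample \<Omega> w' A
    proof
      show "sum w' \<Omega> = 1"
        using Z_pos by (simp add: w'_def sum_divide_distrib[symmetric] Z_def[symmetric])
    qed (use fin w_pos Z_pos ex_empty ex_singleton in \<open>auto simp: w'_def\<close>)
    have "\<epsilon>' \<le> w' r" if "r \<in> \<Omega>" for r
    proof -
      have "s * (e \<bullet> ind r) \<le> 1 * real CARD('a)"
        using s e_ind[of r] by (intro mult_mono) auto
      then have "\<epsilon>' \<le> w r * exp (\<Sum>j\<in>A r. t j)"
        unfolding \<epsilon>'_def t_sum using eps w_pos[OF that] that by (intro mult_mono) auto
      also have "\<dots> \<le> w' r"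
        using Z_pos Z_le w_pos[OF that] by (simp add: w'_def field_simps mult_left_le)
      finally show ?thesis .
    qed
    then have q': "sqrt (real n) ^ CARD('a) * T.q n k \<le> K0"
      unfolding K0_def using eps' n by (intro T.q_upper_bound) auto
    define m where "m = e \<bullet> \<mu>"
    \<comment> \<open>The factor \<open>exp (s * m)\<close> centres the moment generating function,
      so its first-order term vanishes. Its \<open>n\<close>-th power is then at most
      \<open>(1 + E / n) ^ n \<le> exp E\<close>.\<close>
    have "Z * exp (s * m) = (\<Sum>r\<in>\<Omega>. w r * exp (- s * y r))"
      unfolding Z_def t_sum sum_distrib_right
      by (intro sum.cong) (simp_all add: y_def m_def inner_diff_right exp_add[symmetric] algebra_simps)
    also have "\<dots> \<le> (\<Sum>r\<in>\<Omega>. w r * (1 + (- s * y r) + E * s\<^sup>2))"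
    proof (intro sum_mono mult_left_mono)
      fix r assume r: "r \<in> \<Omega>"
      obtain \<xi> where \<xi>: "\<bar>\<xi>\<bar> \<le> \<bar>- s * y r\<bar>"
        "exp (- s * y r) = (\<Sum>m<2. (- s * y r) ^ m / fact m) + exp \<xi> / fact 2 * (- s * y r)\<^sup>2"
        using Maclaurin_exp_le[of "- s * y r" 2] by blast
      have "\<bar>- s * y r\<bar> \<le> 1 * D"
        unfolding abs_mult using s y[OF r] D0 by (intro mult_mono) auto
      with \<xi> have "exp \<xi> \<le> exp D" by simp
      moreover have "(y r)\<^sup>2 \<le> D\<^sup>2"
        using y[OF r] D0 by (simp add: abs_le_square_iff[symmetric])
      ultimately have "exp \<xi> * (y r)\<^sup>2 \<le> E"
        unfolding E_def by (intro mult_mono) auto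
      then have "exp \<xi> * (y r)\<^sup>2 * s\<^sup>2 \<le> E * s\<^sup>2"
        by (intro mult_right_mono) auto
      moreover have "0 \<le> exp \<xi> * (y r)\<^sup>2 * s\<^sup>2" by simp
      ultimately show "exp (- s * y r) \<le> 1 + (- s * y r) + E * s\<^sup>2"
        using \<xi>(2) by (simp add: eval_nat_numeral algebra_simps)
    qed (use w_pos in \<open>auto simp: less_imp_le\<close>)
    also have "\<dots> = sum w \<Omega> * (1 + E * s\<^sup>2) - s * (\<Sum>r\<in>\<Omega>. w r * y r)"
      by (simp add: algebra_simps sum.distrib sum_subtractf sum_distrib_left sum_distrib_right)
    also have "\<dots> = 1 + E * s\<^sup>2"
      unfolding y_def by (simp add: sum_centred w_sum)
    also have "\<dots> \<le> exp (E / real n)"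
      using exp_ge_add_one_self[of "E / real n"] by (simp add: s)
    finally have "(Z * exp (s * m)) ^ n \<le> exp (E / real n) ^ n"
      using Z_pos by (intro power_mono) auto
    also have "\<dots> = exp E"
      using n by (simp add: exp_of_nat_mult[symmetric])
    finally have Zn: "Z ^ n * exp (s * m) ^ n \<le> exp E"
      by (simp add: power_mult_distrib)
    have "T.q n k = q n k * exp (\<Sum>j\<in>UNIV. t j * of_int (k j)) / Z ^ n"
      unfolding w'_def by (rule count_weight_tilt)
    also have "(\<Sum>j\<in>UNIV. t j * of_int (k j)) = - s * (e \<bullet> (\<chi> j. of_int (k j)))"
      by (simp add: t_def inner_vec_def sum_distrib_left sum_negf mult.assoc)
    also have "e \<bullet> (\<chi> j. of_int (k j)) = (\<Sum>j\<in>C. of_int (k j))"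
      by (simp add: e\<mu>)
    \<comment> \<open>Undoing the tilt: the mean shift \<open>exp (s * m) ^ n\<close> pairs with
      \<open>Z ^ n\<close>, and only the deviation of \<open>k\<close> from the mean on the scale
      \<open>sqrt n\<close> is left in the exponent.\<close>
    finally have "q n k = T.q n k * (Z ^ n * exp (s * (\<Sum>j\<in>C. of_int (k j))))"
      using Z_pos by (simp add: exp_minus field_simps)
    moreover have "exp (s * (\<Sum>j\<in>C. of_int (k j)))
        = exp (s * m) ^ n * exp (\<Sum>j\<in>C. (of_int (k j) - real n * \<mu> $ j) / sqrt (real n))"
      by (simp add: m_def e\<mu> s_def exp_of_nat_mult[symmetric] exp_add[symmetric] sum_subtractf
          sum_divide_distrib[symmetric] sum_distrib_left[symmetric] diff_divide_distrib)
    ultimately have "sqrt (real n) ^ CARD('a) * q n k = (sqrt (real n) ^ CARD('a) * T.q n k)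
        * (Z ^ n * exp (s * m) ^ n) * exp (\<Sum>j\<in>C. (of_int (k j) - real n * \<mu> $ j) / sqrt (real n))"
      by simp
    also have "\<dots> \<le> K0 * exp E * exp (\<Sum>j\<in>C. (of_int (k j) - real n * \<mu> $ j) / sqrt (real n))"
      using q' Zn K0 Z_pos T.q_nonneg[of n k] by (intro mult_right_mono mult_mono) auto
    finally show "sqrt (real n) ^ CARD('a) * q n k
      \<le> K0 * exp E * exp (\<Sum>j\<in>C. (of_int (k j) - real n * \<mu> $ j) / sqrt (real n))" .
  qed
qed

lemma q_eq_0_if_negative:
  assumes "k j < 0"
  shows "q n k = 0"
  using assms unfolding count_weight_def by (subst sum.neutral) (auto dest!: spec[of _ j])

text \<open>The normalisation is a balance: the local limit theorem contributes
  \<open>sqrt n ^ CARD('a)\<close>, of which a mesh cell, of volume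
  \<open>1 / sqrt n ^ card C\<close>, leaves the part belonging to \<open>S\<close>. Positivity of
  \<open>J\<close> makes the limit nonzero, as a ratio asymptotic requires.\<close>

lemma orthant_sum:
  fixes \<zeta> :: "'a \<Rightarrow> real" and c :: "nat \<Rightarrow> 'a \<Rightarrow> int"
  assumes \<zeta>: "\<And>j. 0 < \<zeta> j" "\<And>j. \<zeta> j \<le> 1"
    and c: "\<And>n j. real n * \<mu> $ j - 1 \<le> c n j" "\<And>n j. c n j \<le> real n * \<mu> $ j"
  defines "S \<equiv> {j. \<zeta> j < 1}" and "C \<equiv> {j. \<zeta> j = 1}"
  defines "J \<equiv> (\<integral>u. indicator {u. \<forall>j\<in>C. 0 < u j} u
      * exp (- (\<Sum>i\<in>C. \<Sum>k\<in>C. u i * matrix_inv cov $ i $ k * u k) / 2) \<partial>(PiM C (\<lambda>_. lborel)))"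
  shows "(\<lambda>n. sqrt (real n) ^ card S * (\<Sum>l\<in>PiE UNIV (\<lambda>j. {0..c n j}).
            (\<Prod>j\<in>UNIV. \<zeta> j ^ nat (l j)) * q n (\<lambda>j. c n j - l j)))
    \<longlonglongrightarrow> (\<Prod>j\<in>S. 1 / (1 - \<zeta> j)) * J / sqrt ((2 * pi) ^ CARD('a) * det cov)" (is "?T \<longlonglongrightarrow> _")
    and "0 < J"
proof -
  interpret P: product_sigma_finite "\<lambda>_::'a. lborel :: real measure"
    by standard
  have SC: "S \<inter> C = {}" "S \<union> C = UNIV" and memC: "j \<in> C \<longleftrightarrow> j \<notin> S" for j
    using \<zeta> by (auto simp: S_def C_def less_le)
  have \<zeta>1: "\<zeta> j = 1" if "j \<notin> S" for j
    using that \<zeta>(2)[of j] by (auto simp: S_def)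
  let ?PM = "\<lambda>I. (\<Pi>\<^sub>M j\<in>(I::'a set). lborel :: real measure)"
  \<comment> \<open>The sum is the integral of a step function constant on the cells \<open>(l h, (l + 1) h]\<close>. Cells open
    on the left keep its support inside the open orthant, so the convergence holds everywhere.\<close>
  define h where "h = (\<lambda>n j. if j \<in> C then 1 / sqrt (real n) else 1)"
  define l where "l = (\<lambda>n (v::'a \<Rightarrow> real) j. \<lceil>v j / h n j\<rceil> - 1)"
  define f where "f = (\<lambda>n (m::'a \<Rightarrow> int). (\<Prod>j\<in>UNIV. \<zeta> j ^ nat (m j)) * (sqrt (real n) ^ CARD('a) * q n (\<lambda>j. c n j - m j)))"
  define G where "G = (\<lambda>n v. if \<forall>j. 0 < v j then f n (l n v) else 0)"
  define \<Psi> where "\<Psi> = (\<lambda>u::'a \<Rightarrow> real. indicator {u. \<forall>j\<in>C. 0 < u j} u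
      * exp (- (\<Sum>i\<in>C. \<Sum>k\<in>C. u i * matrix_inv cov $ i $ k * u k) / 2))"
  have J: "J = (\<integral>u. \<Psi> u \<partial>?PM C)"
    by (simp only: J_def \<Psi>_def)
  define g where "g = (\<lambda>j (y::real). indicator {0<..} y * \<zeta> j ^ nat (\<lceil>y\<rceil> - 1))"
  define d where "d = sqrt ((2 * pi) ^ CARD('a) * det cov)"
  have d: "d > 0" by (simp add: d_def det_cov_pos)
  define G0 where "G0 = (\<lambda>v. (\<Prod>j\<in>S. g j (v j)) * \<Psi> v / d)"
  have hpos: "h n j > 0" if "n > 0" for n j
    using that by (simp add: h_def)
  let ?L = "\<lambda>n. PiE UNIV (\<lambda>j. {0..c n j})"
  have finL: "finite (?L n)" for n by (intro finite_PiE) auto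
  \<comment> \<open>Beyond \<open>c\<close> some count would be negative, so the sum over the finite
    box is the sum over the whole orthant.\<close>
  have f_outside: "f n m = 0" if "\<And>j. 0 \<le> m j" "m \<notin> ?L n" for n m
  proof -
    have "\<exists>j. c n j - m j < 0" using that by (auto simp: PiE_iff not_le)
    then obtain j where "c n j - m j < 0" ..
    then show ?thesis by (simp add: f_def q_eq_0_if_negative)
  qed
  let ?cell = "\<lambda>n m v. \<Prod>j\<in>UNIV. indicator {real_of_int (m j) * h n j<..(real_of_int (m j) + 1) * h n j} (v j) :: real"
  have cell: "?cell n m v = of_bool (m = l n v)" if "n > 0" for n m v
  proof -
    have "v j \<in> {real_of_int (m j) * h n j<..(real_of_int (m j) + 1) * h n j} \<longleftrightarrow> m j = l n v j" for j
    proof -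
      have "v j \<in> {real_of_int (m j) * h n j<..(real_of_int (m j) + 1) * h n j}
          \<longleftrightarrow> real_of_int (m j) < v j / h n j \<and> v j / h n j \<le> real_of_int (m j) + 1"
        using hpos[OF that, of j] by (simp add: field_simps)
      also have "\<dots> \<longleftrightarrow> m j = l n v j"
        unfolding l_def by linarith
      finally show ?thesis .
    qed
    then show ?thesis by (auto simp: indicator_def fun_eq_iff prod_zero_iff)
  qed
  have G_sum: "G n v = (\<Sum>m\<in>?L n. f n m * ?cell n m v)" if n: "n > 0" for n v
  proof -
    have "(\<Sum>m\<in>?L n. f n m * ?cell n m v) = (\<Sum>m\<in>?L n. if m = l n v then f n (l n v) else 0)"
      unfolding cell[OF n] by (intro sum.cong) auto
    also have "\<dots> = (if l n v \<in> ?L n then f n (l n v) else 0)"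
      using finL by simp
    also have "\<dots> = G n v"
    proof (cases "\<forall>j. 0 < v j")
      case True
      then have "0 \<le> l n v j" for j
        using hpos[OF n, of j] by (simp add: l_def)
      then show ?thesis using True f_outside by (auto simp: G_def)
    next
      case False
      then obtain j where "v j \<le> 0" by (auto simp: not_less)
      then have "v j / h n j \<le> 0"
        using hpos[OF n, of j] by (simp add: field_simps)
      then have "l n v j < 0" unfolding l_def by linarith
      then have "l n v \<notin> ?L n" by (auto simp: PiE_iff not_le)
      moreover have "G n v = 0" using False by (simp only: G_def if_False)
      ultimately show ?thesis by simp
    qed
    finally show ?thesis by simp
  qed
  have cellI: "integrable (?PM UNIV) (?cell n m)" "(\<integral>v. ?cell n m v \<partial>?PM UNIV) = (\<Prod>j\<in>UNIV. h n j)" if "n > 0" for n m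
  proof -
    have i: "integrable lborel (indicator {real_of_int (m j) * h n j<..(real_of_int (m j) + 1) * h n j} :: real \<Rightarrow> real)" for j
      using hpos[OF that, of j] by (intro integrable_real_indicator) (auto simp: algebra_simps)
    show "integrable (?PM UNIV) (?cell n m)"
      by (rule P.product_integrable_prod) (use i in auto)
    have "(\<integral>v. ?cell n m v \<partial>?PM UNIV) = (\<Prod>j\<in>UNIV. \<integral>y. indicator {real_of_int (m j) * h n j<..(real_of_int (m j) + 1) * h n j} y \<partial>lborel)"
      by (rule P.product_integral_prod) (use i in auto)
    also have "\<dots> = (\<Prod>j\<in>UNIV. h n j)"
      using hpos[OF that] by (intro prod.cong) (auto simp: algebra_simps less_imp_le)
    finally show "(\<integral>v. ?cell n m v \<partial>?PM UNIV) = (\<Prod>j\<in>UNIV. h n j)" .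
  qed
  have hprod: "(\<Prod>j\<in>UNIV. h n j) * sqrt (real n) ^ CARD('a) = sqrt (real n) ^ card S" if "n > 0" for n
  proof -
    have "CARD('a) = card S + card C"
      using SC by (metis card_Un_disjoint finite)
    moreover have "(\<Prod>j\<in>UNIV. h n j) = (1 / sqrt (real n)) ^ card C"
      unfolding h_def by (simp add: prod.If_cases)
    ultimately show ?thesis
      using that by (simp add: power_add power_one_over)
  qed
  have G_int: "(\<integral>v. G n v \<partial>?PM UNIV) = ?T n" if n: "n > 0" for n
  proof -
    have "(\<integral>v. G n v \<partial>?PM UNIV) = (\<Sum>m\<in>?L n. f n m * (\<Prod>j\<in>UNIV. h n j))"
      unfolding G_sum[OF n] using cellI[OF n] by (subst Bochner_Integration.integral_sum) auto
    also have "\<dots> = (\<Sum>m\<in>?L n. ((\<Prod>j\<in>UNIV. h n j) * sqrt (real n) ^ CARD('a))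
        * ((\<Prod>j\<in>UNIV. \<zeta> j ^ nat (m j)) * q n (\<lambda>j. c n j - m j)))"
      by (simp add: f_def mult_ac)
    also have "\<dots> = ?T n"
      unfolding hprod[OF n] by (simp add: sum_distrib_left)
    finally show ?thesis .
  qed
  have G_meas: "G n \<in> borel_measurable (?PM UNIV)" if n: "n > 0" for n
    unfolding G_sum[OF n, abs_def] using cellI[OF n]
    by (intro borel_measurable_sum borel_measurable_times) (auto dest: borel_measurable_integrable)
  have G_lim: "(\<lambda>n. G n v) \<longlonglongrightarrow> G0 v" for v
  proof (cases "\<forall>j. 0 < v j")
    case False
    then obtain j where j: "\<not> 0 < v j" by auto
    have "G0 v = 0"
    proof (cases "j \<in> C")
      case True
      then have "v \<notin> {u. \<forall>j\<in>C. 0 < u j}" using j by auto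
      then show ?thesis by (simp add: G0_def \<Psi>_def)
    next
      case False
      then have "g j (v j) = 0" "j \<in> S" using j by (auto simp: g_def memC)
      then have "(\<Prod>j\<in>S. g j (v j)) = 0" by (intro prod_zero) auto
      then show ?thesis by (simp add: G0_def)
    qed
    moreover have "G n v = 0" for n using False by (simp only: G_def if_False)
    ultimately show ?thesis by simp
  next
    case True
    \<comment> \<open>The limit of the standardised deviations of \<open>c - l\<close>: on
      \<open>C\<close> the offset is about \<open>v * sqrt n\<close>, on \<open>S\<close> it stays
      bounded and disappears. The minus sign drops out of the quadratic form.\<close>
    define x :: "real^'a" where "x = (\<chi> j. if j \<in> C then - v j else 0)"
    define k where "k = (\<lambda>n j. c n j - l n v j)"
    have "(\<lambda>n. (of_int (k n j) - real n * \<mu> $ j) / sqrt (real n)) \<longlonglongrightarrow> x $ j" for j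
    proof -
      have c0: "(\<lambda>n. (of_int (c n j) - real n * \<mu> $ j) / sqrt (real n)) \<longlonglongrightarrow> 0"
      proof (rule Lim_null_comparison)
        show "\<forall>\<^sub>F n in sequentially. norm ((of_int (c n j) - real n * \<mu> $ j) / sqrt (real n)) \<le> 1 / sqrt (real n)"
        proof (rule always_eventually, rule allI)
          fix n
          have "\<bar>of_int (c n j) - real n * \<mu> $ j\<bar> \<le> 1" using c[of n j] by linarith
          then show "norm ((of_int (c n j) - real n * \<mu> $ j) / sqrt (real n)) \<le> 1 / sqrt (real n)"
            by (simp add: abs_divide divide_right_mono)
        qed
        show "(\<lambda>n. 1 / sqrt (real n)) \<longlonglongrightarrow> 0" by real_asymp
      qed
      have l0: "(\<lambda>n. of_int (l n v j) / sqrt (real n)) \<longlonglongrightarrow> - (x $ j)"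
      proof (cases "j \<in> C")
        case True
        have "(\<lambda>n. (of_int (\<lceil>v j * sqrt (real n)\<rceil> - 1)) / sqrt (real n)) \<longlonglongrightarrow> v j"
        proof (rule tendsto_sandwich)
          show "(\<lambda>n. v j - 1 / sqrt (real n)) \<longlonglongrightarrow> v j" by real_asymp
          show "(\<lambda>n. v j) \<longlonglongrightarrow> v j" by simp
          show "\<forall>\<^sub>F n in sequentially. v j - 1 / sqrt (real n) \<le> (of_int (\<lceil>v j * sqrt (real n)\<rceil> - 1)) / sqrt (real n)"
            using eventually_gt_at_top[of 0]
          proof eventually_elim
            case (elim n)
            have "v j * sqrt (real n) - 1 \<le> of_int (\<lceil>v j * sqrt (real n)\<rceil> - 1)" by linarith
            from divide_right_mono[OF this, of "sqrt (real n)"] elim show ?case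
              by (simp add: diff_divide_distrib)
          qed
          show "\<forall>\<^sub>F n in sequentially. (of_int (\<lceil>v j * sqrt (real n)\<rceil> - 1)) / sqrt (real n) \<le> v j"
            using eventually_gt_at_top[of 0]
          proof eventually_elim
            case (elim n)
            have "of_int (\<lceil>v j * sqrt (real n)\<rceil> - 1) \<le> v j * sqrt (real n)" by linarith
            from divide_right_mono[OF this, of "sqrt (real n)"] elim show ?case by simp
          qed
        qed
        then show ?thesis using True by (simp add: l_def h_def x_def)
      next
        case False
        then have "(\<lambda>n. of_int (l n v j) / sqrt (real n)) = (\<lambda>n. of_int (\<lceil>v j\<rceil> - 1) / sqrt (real n))"
          by (simp add: l_def h_def)
        moreover have "(\<lambda>n. real_of_int (\<lceil>v j\<rceil> - 1) / sqrt (real n)) \<longlonglongrightarrow> 0" by real_asymp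
        ultimately show ?thesis using False by (simp add: x_def)
      qed
      show ?thesis
        using tendsto_diff[OF c0 l0] by (simp add: k_def diff_divide_distrib add_divide_distrib algebra_simps)
    qed
    from local_limit[OF this]
    have q_lim: "(\<lambda>n. sqrt (real n) ^ CARD('a) * q n (k n)) \<longlonglongrightarrow> exp (- (x \<bullet> (matrix_inv cov *v x)) / 2) / d"
      by (simp add: d_def)
    have quad: "x \<bullet> (matrix_inv cov *v x) = (\<Sum>i\<in>C. \<Sum>k\<in>C. v i * matrix_inv cov $ i $ k * v k)"
    proof -
      have "x \<bullet> (matrix_inv cov *v x) = (\<Sum>i\<in>UNIV. \<Sum>k\<in>UNIV. x $ i * matrix_inv cov $ i $ k * x $ k)"
        by (simp add: inner_vec_def matrix_vector_mult_def sum_distrib_left mult.assoc)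
      also have "\<dots> = (\<Sum>i\<in>C. \<Sum>k\<in>UNIV. x $ i * matrix_inv cov $ i $ k * x $ k)"
        by (rule sum.mono_neutral_right) (auto simp: x_def)
      also have "\<dots> = (\<Sum>i\<in>C. \<Sum>k\<in>C. x $ i * matrix_inv cov $ i $ k * x $ k)"
        by (intro sum.cong refl sum.mono_neutral_right) (auto simp: x_def)
      also have "\<dots> = (\<Sum>i\<in>C. \<Sum>k\<in>C. v i * matrix_inv cov $ i $ k * v k)"
        by (intro sum.cong refl) (auto simp: x_def)
      finally show ?thesis .
    qed
    have prod: "(\<Prod>j\<in>UNIV. \<zeta> j ^ nat (l n v j)) = (\<Prod>j\<in>S. g j (v j))" for n
    proof -
      have "(\<Prod>j\<in>UNIV. \<zeta> j ^ nat (l n v j)) = (\<Prod>j\<in>S. \<zeta> j ^ nat (l n v j))"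
        by (rule prod.mono_neutral_right) (auto simp: \<zeta>1)
      also have "\<dots> = (\<Prod>j\<in>S. g j (v j))"
        using True by (intro prod.cong) (auto simp: g_def l_def h_def memC)
      finally show ?thesis .
    qed
    have "(\<lambda>n. (\<Prod>j\<in>S. g j (v j)) * (sqrt (real n) ^ CARD('a) * q n (k n))) \<longlonglongrightarrow>
        (\<Prod>j\<in>S. g j (v j)) * (exp (- (x \<bullet> (matrix_inv cov *v x)) / 2) / d)"
      by (intro tendsto_mult tendsto_const q_lim)
    also have "(\<lambda>n. (\<Prod>j\<in>S. g j (v j)) * (sqrt (real n) ^ CARD('a) * q n (k n))) = (\<lambda>n. G n v)"
      using True by (simp add: G_def f_def prod k_def)
    also have "(\<Prod>j\<in>S. g j (v j)) * (exp (- (x \<bullet> (matrix_inv cov *v x)) / 2) / d) = G0 v"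
      using True by (simp add: G0_def \<Psi>_def quad)
    finally show ?thesis .
  qed
  obtain K where K: "\<And>n k. n > 0 \<Longrightarrow> sqrt (real n) ^ CARD('a) * q n k
    \<le> K * exp (\<Sum>j\<in>C. (of_int (k j) - real n * \<mu> $ j) / sqrt (real n))"
    using q_tilted_bound[of C] by blast
  \<comment> \<open>The tilted bound comes without a sign for its constant; comparison with a
    nonnegative weight at \<open>n = 1\<close> supplies it.\<close>
  have K0: "K \<ge> 0"
  proof -
    have "0 \<le> sqrt (real 1) ^ CARD('a) * q 1 (\<lambda>_. 0)" using q_nonneg by simp
    also have "\<dots> \<le> K * exp (\<Sum>j\<in>C. (of_int 0 - real 1 * \<mu> $ j) / sqrt (real 1))" by (rule K) simp
    finally show ?thesis by (simp add: zero_le_mult_iff)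
  qed
  \<comment> \<open>Decay rates of the dominating function: on \<open>C\<close> the rate 1 of the
    tilted bound, on \<open>S\<close> the geometric rate. The 1 in the exponent of \<open>b\<close>
    pays for rounding, since the mesh is at most 1.\<close>
  define \<kappa> where "\<kappa> = (\<lambda>j. if j \<in> C then 1 else - ln (\<zeta> j))"
  have \<kappa>: "\<kappa> j > 0" for j
    using \<zeta>[of j] by (auto simp: \<kappa>_def memC S_def)
  define b where "b = (\<lambda>j (y::real). indicator {0<..} y * exp (\<kappa> j * (1 - y)))"
  have bI: "integrable (?PM UNIV) (\<lambda>v. K * (\<Prod>j\<in>UNIV. b j (v j)))"
    unfolding b_def by (intro integrable_mult_right P.product_integrable_prod integrable_exp_neg_half_line \<kappa>) auto
  have G_bound: "norm (G n v) \<le> K * (\<Prod>j\<in>UNIV. b j (v j))" if n: "n > 0" for n v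
  proof (cases "\<forall>j. 0 < v j")
    case False
    then have "G n v = 0" by (simp only: G_def if_False)
    then show ?thesis using K0 by (auto simp: b_def intro!: mult_nonneg_nonneg prod_nonneg)
  next
    case True
    have fnn: "0 \<le> f n m" for m
      unfolding f_def using \<zeta> q_nonneg by (intro mult_nonneg_nonneg prod_nonneg) (auto simp: less_imp_le)
    have l_lb: "v j / h n j - 1 \<le> l n v j" "0 \<le> l n v j" for j
      using True hpos[OF n, of j] by (auto simp: l_def)
    have "norm (G n v) = f n (l n v)"
      using True fnn by (simp add: G_def)
    also have "\<dots> \<le> (\<Prod>j\<in>UNIV. \<zeta> j ^ nat (l n v j)) * (K * exp (\<Sum>j\<in>C. (of_int (c n j - l n v j) - real n * \<mu> $ j) / sqrt (real n)))"
      unfolding f_def using \<zeta> by (intro mult_left_mono K n prod_nonneg) (auto simp: less_imp_le)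
    also have "\<dots> = K * ((\<Prod>j\<in>UNIV. \<zeta> j ^ nat (l n v j)) * (\<Prod>j\<in>UNIV. if j \<in> C then exp ((of_int (c n j - l n v j) - real n * \<mu> $ j) / sqrt (real n)) else 1))"
      by (simp add: exp_sum prod.If_cases)
    also have "\<dots> = K * (\<Prod>j\<in>UNIV. \<zeta> j ^ nat (l n v j) * (if j \<in> C then exp ((of_int (c n j - l n v j) - real n * \<mu> $ j) / sqrt (real n)) else 1))"
      by (simp add: prod.distrib)
    also have "\<dots> \<le> K * (\<Prod>j\<in>UNIV. b j (v j))"
    proof (intro mult_left_mono prod_mono conjI)
      fix j
      show "0 \<le> \<zeta> j ^ nat (l n v j) * (if j \<in> C then exp ((of_int (c n j - l n v j) - real n * \<mu> $ j) / sqrt (real n)) else 1)"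
        using \<zeta>[of j] by simp
      show "\<zeta> j ^ nat (l n v j) * (if j \<in> C then exp ((of_int (c n j - l n v j) - real n * \<mu> $ j) / sqrt (real n)) else 1) \<le> b j (v j)"
      proof (cases "j \<in> C")
        case jC: True
        have "(of_int (c n j - l n v j) - real n * \<mu> $ j) / sqrt (real n) \<le> (1 - v j * sqrt (real n)) / sqrt (real n)"
          using l_lb(1)[of j] c(2)[of n j] jC by (intro divide_right_mono) (auto simp: h_def)
        also have "\<dots> = 1 / sqrt (real n) - v j"
          using n by (simp add: diff_divide_distrib)
        also have "\<dots> \<le> 1 - v j" using n by simp
        finally show ?thesis using jC True by (simp add: b_def \<kappa>_def C_def)
      next
        case jC: False
        have "\<zeta> j ^ nat (l n v j) = exp (of_int (l n v j) * ln (\<zeta> j))"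
          using l_lb(2)[of j] \<zeta>(1)[of j] by (simp add: powr_realpow[symmetric] powr_def)
        also have "\<dots> \<le> exp (\<kappa> j * (1 - v j))"
        proof -
          have "\<kappa> j * (v j - 1) \<le> \<kappa> j * of_int (l n v j)"
            using \<kappa>[of j] l_lb(1)[of j] jC by (intro mult_left_mono) (auto simp: h_def)
          then show ?thesis using jC by (simp add: \<kappa>_def algebra_simps)
        qed
        finally show ?thesis using jC True by (simp add: b_def)
      qed
    qed (use K0 in auto)
    finally show ?thesis .
  qed
  have meas0: "G0 \<in> borel_measurable (?PM UNIV)"
    by (rule borel_measurable_LIMSEQ_real[where u="\<lambda>n. G (Suc n)"]) (auto intro: LIMSEQ_Suc G_lim G_meas)
  have meas: "G (Suc n) \<in> borel_measurable (?PM UNIV)" for n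
    by (rule G_meas) simp
  have conv: "AE v in ?PM UNIV. (\<lambda>n. G (Suc n) v) \<longlonglongrightarrow> G0 v"
    by (intro AE_I2 LIMSEQ_Suc G_lim)
  have dom: "AE v in ?PM UNIV. norm (G (Suc n) v) \<le> K * (\<Prod>j\<in>UNIV. b j (v j))" for n
    by (intro AE_I2 G_bound) simp
  have lim: "(\<lambda>n. \<integral>v. G (Suc n) v \<partial>?PM UNIV) \<longlonglongrightarrow> (\<integral>v. G0 v \<partial>?PM UNIV)"
    by (rule integral_dominated_convergence[OF meas0 meas bI conv dom])
  have G0I: "integrable (?PM UNIV) G0"
    by (rule integrable_dominated_convergence[OF meas0 meas bI conv dom])
  have gI: "integrable lborel (g j)" "(\<integral>y. g j y \<partial>lborel) = 1 / (1 - \<zeta> j)" if "j \<in> S" for j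
  proof -
    show *: "(\<integral>y. g j y \<partial>lborel) = 1 / (1 - \<zeta> j)"
      unfolding g_def using that \<zeta>(1)[of j] by (intro integral_geometric_step) (auto simp: S_def)
    \<comment> \<open>A non-integrable function has Bochner integral 0, so the positive value just
      found proves integrability.\<close>
    then show "integrable lborel (g j)"
      using that not_integrable_integral_eq[of lborel "g j"] by (auto simp: S_def)
  qed
  \<comment> \<open>\<open>G0\<close> is a function of the \<open>S\<close>-coordinates times a
    function of the \<open>C\<close>-coordinates, so Fubini factors the integral. For empty
    \<open>C\<close> the product measure is a unit point mass and \<open>J\<close> is 1.\<close>
  have G0_int: "(\<integral>v. G0 v \<partial>?PM UNIV) = (\<Prod>j\<in>S. 1 / (1 - \<zeta> j)) * J / d"
  proof -
    have "(\<integral>v. G0 v \<partial>?PM (S \<union> C)) = (\<integral>x. (\<integral>y. G0 (merge S C (x, y)) \<partial>?PM C) \<partial>?PM S)"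
      by (rule P.product_integral_fold) (use SC G0I in auto)
    also have "\<dots> = (\<integral>x. (\<integral>y. (\<Prod>j\<in>S. g j (x j)) * \<Psi> y / d \<partial>?PM C) \<partial>?PM S)"
    proof -
      have "\<Psi> (merge S C (x, y)) = \<Psi> y" for x y
        using SC by (simp add: \<Psi>_def indicator_def)
      moreover have "(\<Prod>j\<in>S. g j (merge S C (x, y) j)) = (\<Prod>j\<in>S. g j (x j))" for x y
        using SC by (intro prod.cong) auto
      ultimately show ?thesis by (simp only: G0_def)
    qed
    also have "\<dots> = (\<integral>x. (\<Prod>j\<in>S. g j (x j)) \<partial>?PM S) * J / d"
      by (simp add: J)
    also have "(\<integral>x. (\<Prod>j\<in>S. g j (x j)) \<partial>?PM S) = (\<Prod>j\<in>S. 1 / (1 - \<zeta> j))"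
      using gI by (subst P.product_integral_prod) (auto intro!: prod.cong)
    finally show ?thesis using SC by simp
  qed
  have "(\<lambda>n. ?T (Suc n)) \<longlonglongrightarrow> (\<Prod>j\<in>S. 1 / (1 - \<zeta> j)) * J / d"
    using lim by (simp add: G_int G0_int)
  then show "?T \<longlonglongrightarrow> (\<Prod>j\<in>S. 1 / (1 - \<zeta> j)) * J / sqrt ((2 * pi) ^ CARD('a) * det cov)"
    unfolding d_def by (rule LIMSEQ_imp_Suc)
  have G0_pos: "0 < G0 v" if "\<forall>j. 0 < v j" for v
  proof -
    have "0 < (\<Prod>j\<in>S. g j (v j))"
      using that \<zeta> by (intro prod_pos) (auto simp: g_def)
    then show ?thesis using that d by (simp add: G0_def \<Psi>_def)
  qed
  have G0_nonneg: "0 \<le> G0 v" for v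
    using d \<zeta> by (auto simp: G0_def \<Psi>_def g_def less_imp_le intro!: divide_nonneg_nonneg mult_nonneg_nonneg prod_nonneg)
  \<comment> \<open>\<open>G0\<close> is positive on the open orthant, which contains a half-open
    unit cube of measure 1.\<close>
  have "(\<integral>v. G0 v \<partial>?PM UNIV) \<noteq> 0"
  proof
    assume "(\<integral>v. G0 v \<partial>?PM UNIV) = 0"
    then have "AE v in ?PM UNIV. G0 v = 0"
      using integral_nonneg_eq_0_iff_AE[OF G0I] G0_nonneg by simp
    moreover have "{v \<in> space (?PM UNIV). G0 v \<noteq> 0} \<in> sets (?PM UNIV)"
      using meas0 by measurable
    ultimately have "emeasure (?PM UNIV) {v \<in> space (?PM UNIV). G0 v \<noteq> 0} = 0"
      by (subst (asm) AE_iff_measurable) auto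
    moreover have "PiE UNIV (\<lambda>_. {0<..1}) \<subseteq> {v \<in> space (?PM UNIV). G0 v \<noteq> 0}"
    proof
      fix v :: "'a \<Rightarrow> real" assume "v \<in> PiE UNIV (\<lambda>_. {0<..1})"
      then have "\<forall>j. 0 < v j" by (auto simp: PiE_iff)
      from G0_pos[OF this] show "v \<in> {v \<in> space (?PM UNIV). G0 v \<noteq> 0}"
        by (auto simp: space_PiM)
    qed
    then have "emeasure (?PM UNIV) (PiE UNIV (\<lambda>_. {0<..1})) \<le> emeasure (?PM UNIV) {v \<in> space (?PM UNIV). G0 v \<noteq> 0}"
      by (rule emeasure_mono) fact
    moreover have "emeasure (?PM UNIV) (PiE UNIV (\<lambda>_. {0<..1})) = 1"
      by (subst P.emeasure_PiM) auto
    ultimately show False by simp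
  qed
  then have "0 < (\<integral>v. G0 v \<partial>?PM UNIV)"
    using G0_nonneg by (simp add: order_less_le)
  moreover have "0 < (\<Prod>j\<in>S. 1 / (1 - \<zeta> j))"
    by (intro prod_pos) (auto simp: S_def)
  ultimately show "0 < J"
    using d unfolding G0_int by (simp add: zero_less_mult_iff zero_less_divide_iff)
qed

end

subsection \<open>Rankings and the log-partition function\<close>

lemma has_derivative_sum_exp_axis:
  fixes x :: "'r \<Rightarrow> real^'a::finite"
  shows "((\<lambda>s. \<Sum>r\<in>\<Omega>. a r * exp ((t + s *\<^sub>R axis j 1) \<bullet> x r)) has_real_derivative
    (\<Sum>r\<in>\<Omega>. a r * x r $ j * exp (t \<bullet> x r))) (at 0)"
proof -
  have eq: "(t + s *\<^sub>R axis j 1) \<bullet> x r = t \<bullet> x r + s * x r $ j" for s r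
    by (simp add: inner_add_left inner_commute[of "axis j 1"] inner_axis)
  show ?thesis
    unfolding eq by (auto intro!: derivative_eq_intros sum.cong simp: mult_ac)
qed

text \<open>The weights \<open>p r * exp (t \<bullet> x r) / F t\<close> sum to 1; the gradient of
  the log-partition function is their mean and the Hessian their covariance, written as second
  moment minus product of means.\<close>

lemma
  fixes x :: "'r \<Rightarrow> real^'a::finite"
  assumes \<Omega>: "finite \<Omega>" "\<Omega> \<noteq> {}" and p: "\<And>r. r \<in> \<Omega> \<Longrightarrow> 0 < p r"
  defines "F \<equiv> \<lambda>t. \<Sum>r\<in>\<Omega>. p r * exp (t \<bullet> x r)"
  shows has_derivative_ln_sum_exp: "((\<lambda>s. ln (F (t + s *\<^sub>R axis j 1))) has_real_derivative
      (\<Sum>r\<in>\<Omega>. p r * x r $ j * exp (t \<bullet> x r)) / F t) (at 0)"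
    and hessian_ln_sum_exp: "hessian (\<lambda>t. ln (F t)) t $ i $ k
      = (\<Sum>r\<in>\<Omega>. p r * x r $ i * x r $ k * exp (t \<bullet> x r)) / F t
        - ((\<Sum>r\<in>\<Omega>. p r * x r $ i * exp (t \<bullet> x r)) / F t) * ((\<Sum>r\<in>\<Omega>. p r * x r $ k * exp (t \<bullet> x r)) / F t)"
proof -
  have F_pos: "F t > 0" for t
    unfolding F_def using \<Omega> p by (intro sum_pos) auto
  have F_deriv: "((\<lambda>s. F (t + s *\<^sub>R axis j 1)) has_real_derivative (\<Sum>r\<in>\<Omega>. p r * x r $ j * exp (t \<bullet> x r))) (at 0)" for t j
    unfolding F_def by (rule has_derivative_sum_exp_axis)
  show D: "((\<lambda>s. ln (F (t + s *\<^sub>R axis j 1))) has_real_derivative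
      (\<Sum>r\<in>\<Omega>. p r * x r $ j * exp (t \<bullet> x r)) / F t) (at 0)" for t j
    using DERIV_chain2[OF DERIV_ln_divide F_deriv, of t j] F_pos by simp
  have pd: "partial_deriv (\<lambda>t. ln (F t)) k = (\<lambda>t. (\<Sum>r\<in>\<Omega>. p r * x r $ k * exp (t \<bullet> x r)) / F t)"
    unfolding partial_deriv_def by (intro ext DERIV_imp_deriv D)
  have "((\<lambda>s. (\<Sum>r\<in>\<Omega>. p r * x r $ k * exp ((t + s *\<^sub>R axis i 1) \<bullet> x r)) / F (t + s *\<^sub>R axis i 1)) has_real_derivative
      ((\<Sum>r\<in>\<Omega>. p r * x r $ k * x r $ i * exp (t \<bullet> x r)) * F t
       - (\<Sum>r\<in>\<Omega>. p r * x r $ k * exp (t \<bullet> x r)) * (\<Sum>r\<in>\<Omega>. p r * x r $ i * exp (t \<bullet> x r))) / (F t * F t)) (at 0)"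
    using DERIV_divide[OF has_derivative_sum_exp_axis[where \<Omega>=\<Omega> and a="\<lambda>r. p r * x r $ k" and t=t and j=i and x=x] F_deriv[of t i]] F_pos[of t] by simp
  from DERIV_imp_deriv[OF this] show "hessian (\<lambda>t. ln (F t)) t $ i $ k
      = (\<Sum>r\<in>\<Omega>. p r * x r $ i * x r $ k * exp (t \<bullet> x r)) / F t
        - ((\<Sum>r\<in>\<Omega>. p r * x r $ i * exp (t \<bullet> x r)) / F t) * ((\<Sum>r\<in>\<Omega>. p r * x r $ k * exp (t \<bullet> x r)) / F t)"
    using F_pos[of t] unfolding hessian_def vec_lambda_beta pd partial_deriv_def[of _ i t]
    by (simp add: diff_divide_distrib mult_ac)
qed

section \<open>Rankings with prescribed adversary sets, and the winning event in terms of
  counts\<close>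

lemma finite_rankings: "finite (rankings :: ('a::finite option \<Rightarrow> nat) set)"
proof (rule finite_subset)
  show "(rankings :: ('a option \<Rightarrow> nat) set) \<subseteq> PiE UNIV (\<lambda>_. {..<CARD('a option)})"
    by (auto simp: rankings_def bij_betw_def)
qed (intro finite_PiE; simp)

text \<open>Any enumeration of the candidates, followed by the swap that brings \<open>None\<close>
  to the top.\<close>

lemma ex_ranking_above_empty: "\<exists>r\<in>rankings. above_set r = ({} :: 'a::finite set)"
proof -
  let ?N = "CARD('a option)"
  obtain h :: "'a option \<Rightarrow> nat" where h: "bij_betw h UNIV {0..<?N}"
    using ex_bij_betw_finite_nat[of "UNIV :: 'a option set"] by auto
  define r where "r = Transposition.transpose (h None) 0 \<circ> h"
  have "h None \<in> {0..<?N}" using h by (auto simp: bij_betw_def)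
  then have "bij_betw (Transposition.transpose (h None) 0) {0..<?N} {0..<?N}"
    by (intro permutes_imp_bij permutes_swap_id) auto
  then have "r \<in> rankings"
    using bij_betw_trans[OF h] by (simp add: rankings_def r_def atLeast0LessThan)
  moreover have "r None = 0" by (simp add: r_def)
  ultimately show ?thesis by (intro bexI[of _ r]) (auto simp: above_set_def)
qed

text \<open>Two swaps put \<open>Some j\<close> into position 0 and \<open>None\<close> into
  position 1.\<close>

lemma ex_ranking_above_singleton: "\<exists>r\<in>rankings. above_set r = {j :: 'a::finite}"
proof -
  let ?N = "CARD('a option)"
  have N: "0 < ?N" "1 < ?N" by (simp_all add: card_option)
  obtain h :: "'a option \<Rightarrow> nat" where h: "bij_betw h UNIV {0..<?N}"
    using ex_bij_betw_finite_nat[of "UNIV :: 'a option set"] by auto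
  define r1 where "r1 = Transposition.transpose (h (Some j)) 0 \<circ> h"
  have "h (Some j) \<in> {0..<?N}" using h by (auto simp: bij_betw_def)
  then have "bij_betw (Transposition.transpose (h (Some j)) 0) {0..<?N} {0..<?N}"
    by (intro permutes_imp_bij permutes_swap_id) auto
  then have b1: "bij_betw r1 UNIV {0..<?N}"
    using bij_betw_trans[OF h] by (simp add: r1_def)
  have r1j: "r1 (Some j) = 0" by (simp add: r1_def)
  \<comment> \<open>This keeps position 0 fixed under the second swap, so \<open>Some j\<close>
    stays on top.\<close>
  have r1N: "r1 None \<noteq> 0" using b1 r1j by (metis bij_betw_def injD option.distinct(1))
  define r where "r = Transposition.transpose (r1 None) 1 \<circ> r1"
  have "r1 None \<in> {0..<?N}" using b1 by (auto simp: bij_betw_def)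
  then have "bij_betw (Transposition.transpose (r1 None) 1) {0..<?N} {0..<?N}"
    using N by (intro permutes_imp_bij permutes_swap_id) auto
  then have b: "bij_betw r UNIV {0..<?N}"
    using bij_betw_trans[OF b1] by (simp add: r_def)
  have rN: "r None = 1" by (simp add: r_def)
  have rj: "r (Some j) = 0" using r1N by (simp add: r_def r1j transpose_def)
  have "above_set r = {j}"
  proof -
    have "r (Some i) < 1 \<longleftrightarrow> i = j" for i
      using b rj by (metis bij_betw_def injD less_one option.inject)
    then show ?thesis by (auto simp: above_set_def rN)
  qed
  then show ?thesis using b by (auto simp: rankings_def atLeast0LessThan)
qed

text \<open>Grouping the rankings by \<open>above_set\<close>; it exhibits \<open>Kfun p\<close> as
  the logarithm of a sum of exponentials over rankings.\<close>

lemma Ppoly_eq_sum_rankings: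
  "Ppoly p x = (\<Sum>r\<in>(rankings :: ('a::finite option \<Rightarrow> nat) set). p r * (\<Prod>j\<in>above_set r. x $ j))"
proof -
  have "Ppoly p x = (\<Sum>X\<in>Pow UNIV. \<Sum>r\<in>{r\<in>rankings. above_set r = X}. p r * (\<Prod>j\<in>above_set r. x $ j))"
    unfolding Ppoly_def pX_def sum_distrib_right by (intro sum.cong) auto
  also have "\<dots> = (\<Sum>r\<in>rankings. p r * (\<Prod>j\<in>above_set r. x $ j))"
    by (rule sum.group) (auto simp: finite_rankings)
  finally show ?thesis .
qed

text \<open>No voter ties \<open>m\<close> with \<open>j\<close>, so the winning condition says that
  fewer than \<open>(1 - \<alpha> $ j) * n\<close> voters put \<open>j\<close> above
  \<open>m\<close>; strictness is the reason for the \<open>- 1\<close> after the ceiling. The index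
  \<open>l\<close> is the shortfall from \<open>c\<close>, and it stays below \<open>c\<close>
  because counts are nonnegative.\<close>

lemma prob_winner_eq_count_weights:
  fixes p :: "('a::finite option \<Rightarrow> nat) \<Rightarrow> real" and \<alpha> :: "real^'a"
  defines "c \<equiv> \<lambda>n j. \<lceil>(1 - \<alpha> $ j) * real n\<rceil> - 1"
  shows "prob_winner p \<alpha> n
    = (\<Sum>l\<in>PiE UNIV (\<lambda>j. {0..c n j}). count_weight rankings p above_set n (\<lambda>j. c n j - l j))"
proof -
  let ?V = "PiE {..<n} (\<lambda>_. rankings :: ('a option \<Rightarrow> nat) set)"
  let ?N = "\<lambda>v j. int (counts above_set n v j)"
  have winner: "is_alpha_winner \<alpha> n v \<longleftrightarrow> (\<forall>j. ?N v j \<le> c n j)" if "v \<in> ?V" for v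
  proof -
    have "real (card {i\<in>{..<n}. v i None < v i (Some j)}) > \<alpha> $ j * real n \<longleftrightarrow> ?N v j \<le> c n j" for j
    proof -
      have "v i None \<noteq> v i (Some j)" if "i < n" for i
      proof -
        have "v i \<in> rankings" using \<open>v \<in> ?V\<close> that by auto
        then have "inj (v i)" by (simp add: rankings_def bij_betw_def)
        then show ?thesis by (metis injD option.distinct(1))
      qed
      then have "{i\<in>{..<n}. v i None < v i (Some j)} = {..<n} - {i\<in>{..<n}. j \<in> above_set (v i)}"
        by (auto simp: above_set_def not_less) (metis le_neq_implies_less)
      moreover have "card ({..<n} - {i\<in>{..<n}. j \<in> above_set (v i)}) = n - counts above_set n v j"
        unfolding counts_def by (subst card_Diff_subset) auto
      ultimately have "card {i\<in>{..<n}. v i None < v i (Some j)} = n - counts above_set n v j"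
        by (simp only:)
      moreover have "counts above_set n v j \<le> n"
        unfolding counts_def using card_mono[of "{..<n}" "{i\<in>{..<n}. j \<in> above_set (v i)}"] by auto
      ultimately have "real (card {i\<in>{..<n}. v i None < v i (Some j)}) = real n - real (counts above_set n v j)"
        by simp
      moreover have "?N v j \<le> c n j \<longleftrightarrow> real (counts above_set n v j) < (1 - \<alpha> $ j) * real n"
        unfolding c_def by (subst of_int_of_nat_eq[symmetric], subst less_ceiling_iff[symmetric]) linarith
      ultimately show ?thesis by (simp only: left_diff_distrib mult_1) linarith
    qed
    then show ?thesis by (simp add: is_alpha_winner_def)
  qed
  have finV: "finite ?V" by (intro finite_PiE) (auto simp: finite_rankings)
  let ?W = "{v \<in> ?V. \<forall>j. ?N v j \<le> c n j}"
  have "prob_winner p \<alpha> n = (\<Sum>v\<in>?V. if \<forall>j. ?N v j \<le> c n j then \<Prod>i<n. p (v i) else 0)"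
    unfolding prob_winner_def by (intro sum.cong) (simp_all add: winner)
  also have "\<dots> = (\<Sum>v\<in>?W. \<Prod>i<n. p (v i))"
    by (rule sum.inter_filter[OF finV, symmetric])
  also have "\<dots> = (\<Sum>l\<in>PiE UNIV (\<lambda>j. {0..c n j}). \<Sum>v\<in>{v \<in> ?W. (\<lambda>j. c n j - ?N v j) = l}. \<Prod>i<n. p (v i))"
    by (rule sum.group[symmetric]) (auto intro!: finite_PiE simp: finV)
  also have "\<dots> = (\<Sum>l\<in>PiE UNIV (\<lambda>j. {0..c n j}). count_weight rankings p above_set n (\<lambda>j. c n j - l j))"
  proof (rule sum.cong[OF refl])
    fix l assume "l \<in> PiE UNIV (\<lambda>j. {0..c n j})"
    then have l: "0 \<le> l j" for j by (auto simp: PiE_iff)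
    have eq: "(\<lambda>j. c n j - ?N v j) = l \<longleftrightarrow> (\<forall>j. ?N v j = c n j - l j)" for v
      unfolding fun_eq_iff by (rule iff_allI) linarith
    have "{v \<in> ?W. (\<lambda>j. c n j - ?N v j) = l} = {v \<in> ?V. \<forall>j. ?N v j = c n j - l j}"
      using l by (auto simp: eq)
    then show "(\<Sum>v\<in>{v \<in> ?W. (\<lambda>j. c n j - ?N v j) = l}. \<Prod>i<n. p (v i)) = count_weight rankings p above_set n (\<lambda>j. c n j - l j)"
      by (simp add: count_weight_def)
  qed
  finally show ?thesis .
qed

section \<open>The tilt at the maximiser and the resulting asymptotic ratio\<close>

theorem theorem6:
  fixes p :: "('a::finite option \<Rightarrow> nat) \<Rightarrow> real"
    and \<alpha> \<tau> :: "real^'a"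
  assumes p_pos: "\<forall>r\<in>rankings. p r > 0"
    and p_sum: "sum p rankings = 1"
    and alpha: "\<forall>j. 0 < \<alpha> $ j \<and> \<alpha> $ j < 1"
  defines "\<beta> \<equiv> (\<chi> j. 1 - \<alpha> $ j)"
  assumes tau_max: "\<forall>t. - Kfun p t + \<beta> \<bullet> t \<le> - Kfun p \<tau> + \<beta> \<bullet> \<tau>"
  defines "\<zeta> \<equiv> (\<chi> j. exp (\<tau> $ j))"
  defines "S \<equiv> {j. \<zeta> $ j < 1}"
  defines "C \<equiv> {j. \<zeta> $ j = 1}"
  defines "H \<equiv> hessian (Kfun p) \<tau>"
  defines "M \<equiv> matrix_inv H"
  assumes SC: "S \<union> C = UNIV"
  shows "(\<lambda>n. prob_winner p \<alpha> n) \<sim>[at_top]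
    (\<lambda>n. Ppoly p \<zeta> ^ n
          / (\<Prod>j\<in>S. (1 - \<zeta> $ j) * \<zeta> $ j powr (real_of_int (\<lceil>\<beta> $ j * real n\<rceil> - 1)))
          * (1 / sqrt ((2 * pi) ^ CARD('a) * real n ^ card S * det H))
          * (\<integral>u. indicator {u. \<forall>j\<in>C. 0 < u j} u
                   * exp (- (\<Sum>i\<in>C. \<Sum>k\<in>C. u i * M $ i $ k * u k) / 2)
               \<partial>(PiM C (\<lambda>_. lborel))))"
proof -
  let ?R = "rankings :: ('a option \<Rightarrow> nat) set"
  define ix :: "('a option \<Rightarrow> nat) \<Rightarrow> real^'a" where "ix = (\<lambda>r. \<chi> j. of_bool (j \<in> above_set r))"
  define F where "F = (\<lambda>t. \<Sum>r\<in>?R. p r * exp (t \<bullet> ix r))"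
  have F_eq: "F t = (\<Sum>r\<in>?R. p r * exp (t \<bullet> ix r))" for t by (simp add: F_def)
  define Z where "Z = F \<tau>"
  \<comment> \<open>The tilt by \<open>\<zeta>\<close>, normalised by \<open>Z\<close>, which is the
    value of the polynomial at \<open>\<zeta>\<close>.\<close>
  define w where "w = (\<lambda>r. p r * exp (\<Sum>j\<in>above_set r. \<tau> $ j) / Z)"
  have p_pos': "p r > 0" if "r \<in> ?R" for r using p_pos that by blast
  have ne: "?R \<noteq> {}" using ex_ranking_above_empty by blast
  have ix_inner: "t \<bullet> ix r = (\<Sum>j\<in>above_set r. t $ j)" for t r
  proof -
    have "t \<bullet> ix r = (\<Sum>j\<in>UNIV. if j \<in> above_set r then t $ j else 0)"
      unfolding inner_vec_def ix_def by (intro sum.cong) auto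
    then show ?thesis by (simp add: sum.If_cases)
  qed
  have P_exp: "Ppoly p (\<chi> j. exp (t $ j)) = F t" for t
    unfolding Ppoly_eq_sum_rankings F_def ix_inner by (simp add: exp_sum)
  have K: "Kfun p = (\<lambda>t. ln (F t))"
    by (simp add: fun_eq_iff Kfun_def P_exp)
  have Z: "Z > 0" "Ppoly p \<zeta> = Z"
    unfolding Z_def using finite_rankings ne p_pos'
    by (auto simp: F_def \<zeta>_def P_exp intro!: sum_pos)
  interpret lattice_sample ?R w above_set
  proof
    have "sum w ?R = F \<tau> / Z"
      by (simp add: w_def F_def ix_inner sum_divide_distrib)
    then show "sum w ?R = 1"
      using Z(1) by (simp add: Z_def)
  qed (use finite_rankings p_pos' Z ex_ranking_above_empty ex_ranking_above_singleton in \<open>auto simp: w_def\<close>)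
  have ind: "ind = ix" by (simp add: fun_eq_iff ind_def ix_def)
  have wZ: "w r = p r * exp (\<tau> \<bullet> ix r) / Z" for r
    by (simp add: w_def ix_inner)
  have \<mu>j: "\<mu> $ j = (\<Sum>r\<in>?R. p r * ix r $ j * exp (\<tau> \<bullet> ix r)) / Z" for j
    by (simp add: \<mu>_def ind wZ sum_divide_distrib mult_ac)
  have H: "H = cov"
  proof -
    have "H $ i $ k = cov $ i $ k" for i k
    proof -
      have "H $ i $ k = (\<Sum>r\<in>?R. w r * (ix r $ i * ix r $ k)) - \<mu> $ i * \<mu> $ k"
        using hessian_ln_sum_exp[where p=p and x=ix and t=\<tau> and i=i and k=k, OF finite_rankings ne, folded F_eq, folded Z_def] p_pos'
        unfolding H_def K \<mu>j by (simp add: wZ sum_divide_distrib mult_ac)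
      moreover have "cov $ i $ k = (\<Sum>r\<in>?R. w r * (ix r $ i * ix r $ k)) - \<mu> $ i * (\<Sum>r\<in>?R. w r * ix r $ k)
          - \<mu> $ k * (\<Sum>r\<in>?R. w r * ix r $ i) + \<mu> $ i * \<mu> $ k * sum w ?R"
        by (simp add: cov_def ind algebra_simps sum.distrib sum_subtractf sum_distrib_left sum_distrib_right)
      moreover have "(\<Sum>r\<in>?R. w r * ix r $ j) = \<mu> $ j" for j
        by (simp add: \<mu>_def ind)
      ultimately show ?thesis by (simp add: w_sum)
    qed
    then show ?thesis by (simp add: vec_eq_iff)
  qed
  have \<mu>: "\<mu> = \<beta>"
  proof -
    have "\<mu> $ j = \<beta> $ j" for j
    proof -
      have ax: "\<beta> \<bullet> (\<tau> + s *\<^sub>R axis j 1) = \<beta> \<bullet> \<tau> + s * \<beta> $ j" for s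
        by (simp add: inner_add_right inner_axis)
      \<comment> \<open>Along each axis through \<open>\<tau>\<close> the objective is maximal at
        \<open>s = 0\<close>. Its derivative there is \<open>\<beta> $ j - \<mu> $ j\<close>,
        because the gradient of \<open>Kfun p\<close> at \<open>\<tau>\<close> is the tilted
        mean.\<close>
      have "((\<lambda>s. - Kfun p (\<tau> + s *\<^sub>R axis j 1) + \<beta> \<bullet> (\<tau> + s *\<^sub>R axis j 1)) has_real_derivative - \<mu> $ j + \<beta> $ j) (at 0)"
        unfolding ax K \<mu>j
        by (rule derivative_eq_intros has_derivative_ln_sum_exp[where p=p and x=ix and t=\<tau>, OF finite_rankings ne, folded F_eq, folded Z_def]
            p_pos' refl | assumption)+ simp
      from DERIV_local_max[OF this zero_less_one] tau_max show ?thesis by simp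
    qed
    then show ?thesis by (simp add: vec_eq_iff)
  qed
  have \<zeta>: "0 < \<zeta> $ j" "\<zeta> $ j \<le> 1" for j
  proof -
    show "0 < \<zeta> $ j" by (simp add: \<zeta>_def)
    have "j \<in> S \<union> C" using SC by simp
    then show "\<zeta> $ j \<le> 1" by (auto simp: S_def C_def)
  qed
  define c where "c = (\<lambda>n j. \<lceil>\<beta> $ j * real n\<rceil> - 1)"
  define J where "J = (\<integral>u. indicator {u. \<forall>j\<in>C. 0 < u j} u
      * exp (- (\<Sum>i\<in>C. \<Sum>k\<in>C. u i * M $ i $ k * u k) / 2) \<partial>(PiM C (\<lambda>_. lborel)))"
  define \<Sigma> where "\<Sigma> = (\<lambda>n. \<Sum>l\<in>PiE UNIV (\<lambda>j. {0..c n j}).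
            (\<Prod>j\<in>UNIV. \<zeta> $ j ^ nat (l j)) * q n (\<lambda>j. c n j - l j))"
  define L where "L = (\<Prod>j\<in>S. 1 / (1 - \<zeta> $ j)) * J / sqrt ((2 * pi) ^ CARD('a) * det H)"
  \<comment> \<open>\<open>\<lceil>x\<rceil> - 1\<close> is the largest integer strictly below
    \<open>x\<close>, so it lies within 1 of \<open>x\<close>.\<close>
  have c: "real n * \<mu> $ j - 1 \<le> c n j" "c n j \<le> real n * \<mu> $ j" for n j
    unfolding c_def \<mu> mult.commute[of "real n"] by linarith+
  have \<Sigma>_lim: "(\<lambda>n. sqrt (real n) ^ card S * \<Sigma> n) \<longlonglongrightarrow> L" and J_pos: "0 < J"
    using orthant_sum[of "\<lambda>j. \<zeta> $ j" c, OF \<zeta> c]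
    by (simp_all only: \<Sigma>_def L_def J_def M_def H S_def C_def)
  have L_pos: "0 < L"
    unfolding L_def H using J_pos det_cov_pos by (intro divide_pos_pos mult_pos_pos prod_pos) (auto simp: S_def)
  \<comment> \<open>\<open>powr\<close> is defined also for the exponent \<open>-1\<close>, which
    occurs at \<open>n = 0\<close>.\<close>
  define B where "B = (\<lambda>n. \<Prod>j\<in>S. \<zeta> $ j powr real_of_int (c n j))"
  have B_pos: "B n > 0" for n
    unfolding B_def using \<zeta> by (intro prod_pos) (auto simp: less_le)
  have prob: "prob_winner p \<alpha> n = Z ^ n / B n * \<Sigma> n" for n
  proof -
    have "count_weight ?R p above_set n (\<lambda>j. c n j - l j)
        = Z ^ n / B n * ((\<Prod>j\<in>UNIV. \<zeta> $ j ^ nat (l j)) * q n (\<lambda>j. c n j - l j))"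
      if l: "l \<in> PiE UNIV (\<lambda>j. {0..c n j})" for l
    proof -
      let ?k = "\<lambda>j. c n j - l j"
      have "q n ?k = count_weight ?R p above_set n ?k * exp (\<Sum>j\<in>UNIV. \<tau> $ j * of_int (?k j)) / Z ^ n"
        unfolding w_def by (rule count_weight_tilt)
      also have "exp (\<Sum>j\<in>UNIV. \<tau> $ j * of_int (?k j)) = (\<Prod>j\<in>UNIV. \<zeta> $ j powr of_int (c n j) / \<zeta> $ j ^ nat (l j))"
        unfolding exp_sum[OF finite]
      proof (rule prod.cong[OF refl])
        fix j
        have "0 \<le> l j" using l by (auto simp: PiE_iff)
        then have "\<zeta> $ j ^ nat (l j) = \<zeta> $ j powr of_int (l j)"
          using \<zeta>(1)[of j] by (simp add: powr_realpow[symmetric])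
        then show "exp (\<tau> $ j * of_int (?k j)) = \<zeta> $ j powr of_int (c n j) / \<zeta> $ j ^ nat (l j)"
          by (simp add: \<zeta>_def powr_def exp_diff[symmetric] algebra_simps)
      qed
      also have "\<dots> = (\<Prod>j\<in>UNIV. \<zeta> $ j powr of_int (c n j)) / (\<Prod>j\<in>UNIV. \<zeta> $ j ^ nat (l j))"
        by (rule prod_dividef)
      also have "(\<Prod>j\<in>UNIV. \<zeta> $ j powr of_int (c n j)) = B n"
      proof -
        have "\<zeta> $ j = 1" if "j \<notin> S" for j using that SC by (auto simp: C_def)
        then show ?thesis unfolding B_def by (intro prod.mono_neutral_right) auto
      qed
      finally have qk: "q n ?k = count_weight ?R p above_set n ?k * (B n / (\<Prod>j\<in>UNIV. \<zeta> $ j ^ nat (l j))) / Z ^ n" .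
      have D_pos: "(\<Prod>j\<in>UNIV. \<zeta> $ j ^ nat (l j)) > 0"
        using \<zeta> by (intro prod_pos) auto
      have "a = z / b * (D * x)" if "x = a * (b / D) / z" "D > 0" "b > 0" "z > 0" for a z b D x :: real
        using that by (simp add: field_simps)
      from this[OF qk D_pos B_pos zero_less_power[OF Z(1)]] show ?thesis .
    qed
    then show ?thesis
      unfolding prob_winner_eq_count_weights \<Sigma>_def sum_distrib_left
      by (intro sum.cong) (auto simp: c_def \<beta>_def)
  qed
  have rhs: "Ppoly p \<zeta> ^ n
          / (\<Prod>j\<in>S. (1 - \<zeta> $ j) * \<zeta> $ j powr (real_of_int (\<lceil>\<beta> $ j * real n\<rceil> - 1)))
          * (1 / sqrt ((2 * pi) ^ CARD('a) * real n ^ card S * det H)) * J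
      = Z ^ n / B n * (L / sqrt (real n) ^ card S)" for n
    unfolding Z(2) L_def B_def c_def
    by (simp add: prod.distrib prod_dividef real_sqrt_mult real_sqrt_power mult_ac)
  have "(\<lambda>n. prob_winner p \<alpha> n) \<sim>[at_top] (\<lambda>n. Z ^ n / B n * (L / sqrt (real n) ^ card S))"
  proof (rule asymp_equivI')
    \<comment> \<open>Both sides contain \<open>Z ^ n / B n\<close>, so their ratio is a convergent
      sequence divided by its nonzero limit.\<close>
    have "(\<lambda>n. sqrt (real n) ^ card S * \<Sigma> n / L) \<longlonglongrightarrow> L / L"
      using \<Sigma>_lim L_pos by (intro tendsto_divide tendsto_const) auto
    then have "(\<lambda>n. sqrt (real n) ^ card S * \<Sigma> n / L) \<longlonglongrightarrow> 1"
      using L_pos by simp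
    moreover have "sqrt (real n) ^ card S * \<Sigma> n / L
        = prob_winner p \<alpha> n / (Z ^ n / B n * (L / sqrt (real n) ^ card S))" for n
      unfolding prob using Z(1) B_pos[of n] L_pos by (simp add: field_simps)
    ultimately show "(\<lambda>n. prob_winner p \<alpha> n / (Z ^ n / B n * (L / sqrt (real n) ^ card S))) \<longlonglongrightarrow> 1"
      by simp
  qed
  then show ?thesis
    unfolding rhs[symmetric] J_def .
qed

end
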